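(* Let $\alpha\in(0,1)$ and for every $\varepsilon>0$ let $\rho_\varepsilon:\mathbb{R}^d\to[0,\infty]$ be a measurable radial kernel with essential support $\overline{B_\varepsilon(0)}$. Assume that, as $\varepsilon\to\infty$, $$\min\{1,|\cdot|^{-1}\}\,\rho_\varepsilon(\cdot)\ \to\ \min\{1,|\cdot|^{-1}\}\,\frac{1}{|\cdot|^{d+\alpha-1}}\qquad\text{pointwise a.e. and in }L^1(\mathbb{R}^d).$$ Then, with respect to the convergence in $\mathcal{M}_d$, $$\Gamma\text{-}\lim_{\varepsilon\to\infty}\mathbb{P}^c_\varepsilon=\mathbb{P}_\alpha .$$
   Context: $\mathcal{M}_d$ is the collection of Lebesgue measurable subsets of $\mathbb{R}^d$ (infinite measure allowed) with the convergence in measure: $E_n\to E$ iff $|E_n\Delta E|\to0$. For $E\in\mathcal{M}_d$, $$\mathbb{P}_\varepsilon(E):=\int_{\mathbb{R}^d}\int_{\mathbb{R}^d}\frac{|\mathbf{1}_E(x)-\mathbf{1}_E(y)|}{|x-y|}\rho_\varepsilon(x-y)\,dx\,dy,\qquad \mathbb{P}_\alpha(E):=\int_{\mathbb{R}^d}\int_{\mathbb{R}^d}\frac{|\mathbf{1}_E(x)-\mathbf{1}_E(y)|}{|x-y|^{d+\alpha}}\,dx\,dy .$$ A set $E$ with $\mathbb{P}_\varepsilon(E)<\infty$ is $\varepsilon$-decomposable if there is a partition $\{E_1,E_2\}$ of $E$ into sets of finite $\mathbb{P}_\varepsilon$-perimeter with $|E_1|,|E_2|>0$ and $\mathbb{P}_\varepsilon(E)=\mathbb{P}_\varepsilon(E_1)+\mathbb{P}_\varepsilon(E_2)$;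 otherwise $\varepsilon$-indecomposable. The connected perimeter $\mathbb{P}^c_\varepsilon:\mathcal{M}_d\to[0,\infty]$ is $\mathbb{P}^c_\varepsilon(E):=\mathbb{P}_\varepsilon(E)$ if $E$ is $\varepsilon$-indecomposable and $\mathbb{P}^c_\varepsilon(E):=\infty$ otherwise. The $\Gamma$-limit as $\varepsilon\to\infty$ is understood along every sequence $\varepsilon_n\to\infty$. *)

theory Defs
  imports "HOL-Analysis.Analysis"
begin

text \<open>
  The space \<open>\<real>\<^sup>d\<close> is an arbitrary type \<^typ>\<open>'a::euclidean_space\<close> with \<open>d = DIM('a)\<close>; its Lebesgue
  measurable sets are \<^term>\<open>sets lebesgue\<close>. The integrands below are \<open>0\<close> on the diagonal \<open>x = y\<close>,
  because of \<open>0 / 0 = 0\<close> and \<open>0 * \<infinity> = 0\<close>; the diagonal is a null set.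
\<close>

definition nonlocal_perimeter :: "('a::euclidean_space \<Rightarrow> ennreal) \<Rightarrow> 'a set \<Rightarrow> ennreal" where
  "nonlocal_perimeter \<rho> E =
     (\<integral>\<^sup>+ x. (\<integral>\<^sup>+ y. ennreal (\<bar>indicat_real E x - indicat_real E y\<bar> / norm (x - y)) * \<rho> (x - y)
        \<partial>lebesgue) \<partial>lebesgue)"

definition fractional_perimeter :: "real \<Rightarrow> 'a::euclidean_space set \<Rightarrow> ennreal" where
  "fractional_perimeter \<alpha> E =
     (\<integral>\<^sup>+ x. (\<integral>\<^sup>+ y. ennreal (\<bar>indicat_real E x - indicat_real E y\<bar>
                              / norm (x - y) powr (real DIM('a) + \<alpha>))
        \<partial>lebesgue) \<partial>lebesgue)"

definition decomposable :: "('a::euclidean_space \<Rightarrow> ennreal) \<Rightarrow> 'a set \<Rightarrow> bool" where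
  "decomposable \<rho> E \<longleftrightarrow>
     nonlocal_perimeter \<rho> E < \<infinity> \<and>
     (\<exists>E1 \<in> sets lebesgue. \<exists>E2 \<in> sets lebesgue.
        E1 \<union> E2 = E \<and> E1 \<inter> E2 = {} \<and>
        nonlocal_perimeter \<rho> E1 < \<infinity> \<and> nonlocal_perimeter \<rho> E2 < \<infinity> \<and>
        emeasure lebesgue E1 > 0 \<and> emeasure lebesgue E2 > 0 \<and>
        nonlocal_perimeter \<rho> E = nonlocal_perimeter \<rho> E1 + nonlocal_perimeter \<rho> E2)"

text \<open>Both notions are reserved for sets of finite perimeter. This does not affect the
  connected perimeter, which is \<open>\<infinity>\<close> on sets of infinite perimeter in any case.\<close>

definition indecomposable :: "('a::euclidean_space \<Rightarrow> ennreal) \<Rightarrow> 'a set \<Rightarrow> bool" where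
  "indecomposable \<rho> E \<longleftrightarrow> nonlocal_perimeter \<rho> E < \<infinity> \<and> \<not> decomposable \<rho> E"

definition connected_perimeter :: "('a::euclidean_space \<Rightarrow> ennreal) \<Rightarrow> 'a set \<Rightarrow> ennreal" where
  "connected_perimeter \<rho> E = (if indecomposable \<rho> E then nonlocal_perimeter \<rho> E else \<infinity>)"

definition radial :: "('a::real_normed_vector \<Rightarrow> 'b) \<Rightarrow> bool" where
  "radial f \<longleftrightarrow> (\<exists>g. \<forall>x. f x = g (norm x))"

definition essential_support :: "('a::euclidean_space \<Rightarrow> 'b::zero) \<Rightarrow> 'a set" where
  "essential_support f = - \<Union>{U. open U \<and> (AE x in lebesgue. x \<in> U \<longrightarrow> f x = 0)}"

definition converges_in_measure :: "(nat \<Rightarrow> 'a::euclidean_space set) \<Rightarrow> 'a set \<Rightarrow> bool" where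
  "converges_in_measure En E \<longleftrightarrow>
     (\<lambda>n. emeasure lebesgue ((En n - E) \<union> (E - En n))) \<longlonglongrightarrow> 0"

text \<open>Since convergence in measure is induced by the extended pseudometric \<open>|E \<Delta> F|\<close>,
  the sequential form of \<open>\<Gamma>\<close>-convergence is the appropriate one.\<close>

definition Gamma_converges ::
    "(nat \<Rightarrow> 'a::euclidean_space set \<Rightarrow> ennreal) \<Rightarrow> ('a set \<Rightarrow> ennreal) \<Rightarrow> bool" where
  "Gamma_converges F G \<longleftrightarrow>
     (\<forall>E \<in> sets lebesgue.
        (\<forall>En. (\<forall>n. En n \<in> sets lebesgue) \<and> converges_in_measure En E
           \<longrightarrow> G E \<le> liminf (\<lambda>n. F n (En n))) \<and>
        (\<exists>En. (\<forall>n. En n \<in> sets lebesgue) \<and> converges_in_measure En E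
           \<and> limsup (\<lambda>n. F n (En n)) \<le> G E))"

text \<open>Convergence in \<open>L\<^sup>1(\<real>\<^sup>d)\<close> along a filter for functions with values in \<open>[0,\<infinity>]\<close>. As \<^typ>\<open>ennreal\<close>
  has truncated subtraction, the summand \<open>(a - b) + (b - a)\<close> is \<open>|a - b|\<close> (and \<open>\<infinity>\<close> as soon as
  \<open>a\<close> or \<open>b\<close> is \<open>\<infinity>\<close>). The limit is required to be integrable; the functions along the filter
  are then eventually integrable.\<close>

definition tendsto_L1 ::
    "('i \<Rightarrow> 'a::euclidean_space \<Rightarrow> ennreal) \<Rightarrow> ('a \<Rightarrow> ennreal) \<Rightarrow> 'i filter \<Rightarrow> bool" where
  "tendsto_L1 f g F \<longleftrightarrow>
     (\<integral>\<^sup>+ x. g x \<partial>lebesgue) < \<infinity> \<and>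
     ((\<lambda>i. \<integral>\<^sup>+ x. (f i x - g x) + (g x - f i x) \<partial>lebesgue) \<longlongrightarrow> 0) F"

definition cutoff_weight :: "'a::real_normed_vector \<Rightarrow> real" where
  "cutoff_weight x = min 1 (1 / norm x)"

definition fractional_kernel :: "real \<Rightarrow> 'a::euclidean_space \<Rightarrow> real" where
  "fractional_kernel \<alpha> x = 1 / norm x powr (real DIM('a) + \<alpha> - 1)"

end

theory Submission
  imports Defs
begin

text \<open>
  Substituting \<open>z = x - y\<close> writes every perimeter here as an energy
  \<open>\<integral> k z * |E \<Delta> (E + z)| dz\<close> with a kernel \<open>k\<close>: \<open>k\<^sub>n z = \<rho>\<^sub>\<epsilon> z / |z|\<close> along the sequence, and
  \<open>\<kappa> z = 1 / |z|\<^sup>d\<^sup>+\<^sup>\<alpha>\<close> in the limit. The hypothesis says that \<open>k\<^sub>n\<close> converges to \<open>\<kappa>\<close> almost everywhere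
  and in \<open>L\<^sup>1\<close> with weight \<open>min 1 |z|\<close>. The same energy makes sense for functions \<open>u\<close> in place of
  indicators, with \<open>\<integral> |u x - u (x - z)| dx\<close> in place of \<open>|E \<Delta> (E + z)|\<close>.

  Lower bound. The connected perimeter dominates the perimeter, so it suffices to bound the latter
  from below. The kernels \<open>inf\<^bsub>m \<ge> j\<^esub> k\<^sub>m\<close>, cut off near the origin, are integrable, and the energy with an
  integrable kernel is Lipschitz in the \<open>L\<^sup>1\<close> distance of the functions. They increase to \<open>\<kappa>\<close>, and
  monotone convergence concludes (\<open>energy_le_liminf\<close>).

  Upper bound. A set of finite fractional perimeter has finite measure or a complement of finite
  measure (\<open>finite_or_cofinite_measure\<close>); passing to complements, let its measure be finite. Its
  indicator is cut off at a large radius and averaged over small balls. This raises the energy only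
  slightly and yields a function \<open>v\<close> with values in \<open>[0, 1]\<close>, bounded support and
  \<open>\<integral> |v x - v (x - z)| dx \<le> C min 1 |z|\<close> (\<open>approximate_by_bounded_lipschitz\<close>). For such \<open>v\<close>
  weighted \<open>L\<^sup>1\<close> convergence of the kernels bounds the energies from above in the limit
  (\<open>energy_le_excess\<close>). By the coarea formula some superlevel set of \<open>v\<close>, at a level that may depend on
  \<open>n\<close>, has at most the energy of \<open>v\<close> up to a factor near \<open>1\<close> (\<open>coarea_level\<close>). Choosing the level
  after \<open>n\<close> avoids any regularity theory for the superlevel sets.

  The superlevel sets all lie in one ball \<open>B\<^sub>R\<close>, and as soon as \<open>R < \<epsilon> / 2\<close> both they and their
  complements are indecomposable (\<open>indecomposableI\<close>). A decomposition into \<open>E\<^sub>1\<close> and \<open>E\<^sub>2\<close> would force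
  \<open>\<integral> k z * |E\<^sub>1 \<inter> (E\<^sub>2 + z)| dz = 0\<close>. However, if both parts have positive measure in a common ball
  of radius \<open>\<epsilon> / 2\<close>, a Steinhaus argument makes \<open>|E\<^sub>1 \<inter> (E\<^sub>2 + z)|\<close> positive on a nonempty open
  set of shifts \<open>|z| < \<epsilon>\<close>, on which \<open>k\<close> cannot vanish almost everywhere, by the assumption on the
  essential support. For a set inside a ball of radius \<open>\<epsilon> / 2\<close> such a common ball is at hand; for the
  complement of a small ball it exists because \<open>\<real>\<^sup>d\<close> is connected.

  A diagonal choice over approximations of accuracy \<open>1 / (j + 1)\<close> gives the recovery sequence.
\<close>

section \<open>Reflections and translations of Lebesgue measure\<close>

lemma lborel_distr_reflect:
  "distr lborel borel (\<lambda>y. x - y) = (lborel :: 'a::euclidean_space measure)"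
  using lborel_affine[of "-1" x] by (simp add: density_1)

lemma lborel_distr_translate:
  "distr lborel borel (\<lambda>y. y - z) = (lborel :: 'a::euclidean_space measure)"
  using lborel_affine[of 1 "-z"] by (simp add: density_1)

lemma nn_integral_lborel_reflect:
  fixes f :: "'a::euclidean_space \<Rightarrow> ennreal"
  assumes [measurable]: "f \<in> borel_measurable borel"
  shows "(\<integral>\<^sup>+ y. f (x - y) \<partial>lborel) = (\<integral>\<^sup>+ y. f y \<partial>lborel)"
  by (subst (2) lborel_distr_reflect[of x, symmetric]) (simp add: nn_integral_distr)

lemma nn_integral_lborel_translate:
  fixes f :: "'a::euclidean_space \<Rightarrow> ennreal"
  assumes [measurable]: "f \<in> borel_measurable borel"
  shows "(\<integral>\<^sup>+ y. f (y - z) \<partial>lborel) = (\<integral>\<^sup>+ y. f y \<partial>lborel)"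
  by (subst (2) lborel_distr_translate[of z, symmetric]) (simp add: nn_integral_distr)

lemma AE_lborel_reflect:
  fixes P :: "'a::euclidean_space \<Rightarrow> bool"
  assumes "AE y in lborel. P y"
  shows "AE y in lborel. P (x - y)"
proof (rule AE_distrD[where M' = borel and f = "\<lambda>y. x - y" and P = P])
  show "(\<lambda>y. x - y) \<in> lborel \<rightarrow>\<^sub>M borel" by simp
  show "AE y in distr lborel borel (\<lambda>y. x - y). P y"
    unfolding lborel_distr_reflect by (fact assms)
qed

section \<open>Increments and energies\<close>

definition increment :: "('a::euclidean_space \<Rightarrow> real) \<Rightarrow> 'a \<Rightarrow> ennreal" where
  "increment u z = (\<integral>\<^sup>+ x. ennreal \<bar>u x - u (x - z)\<bar> \<partial>lborel)"

text \<open>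
  The factor \<open>k z\<close> stands outside the inner integral, so that all estimates on an energy reduce to
  pointwise estimates of \<open>increment u z\<close>.
\<close>

definition energy :: "('a::euclidean_space \<Rightarrow> ennreal) \<Rightarrow> ('a \<Rightarrow> real) \<Rightarrow> ennreal" where
  "energy k u = (\<integral>\<^sup>+ z. k z * increment u z \<partial>lborel)"

lemma measurable_increment [measurable]:
  fixes u :: "'a::euclidean_space \<Rightarrow> real"
  assumes [measurable]: "u \<in> borel_measurable borel"
  shows "increment u \<in> borel_measurable borel"
  unfolding increment_def by measurable

text \<open>
  A Lebesgue measurable kernel composed with \<open>x - y\<close> need not be measurable for the product of the
  Lebesgue measures, so Tonelli's theorem applies only to Borel representatives. Exchanging the data on
  null sets changes the inner integral for a null set of \<open>x\<close> at most, because reflections and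
  translations preserve null sets.
\<close>

lemma double_integral_eq_energy:
  fixes k k' :: "'a::euclidean_space \<Rightarrow> ennreal" and u u' :: "'a \<Rightarrow> real"
  assumes [measurable]: "k' \<in> borel_measurable borel" "u' \<in> borel_measurable borel"
    and k: "AE z in lborel. k z = k' z" and u: "AE x in lborel. u x = u' x"
  shows "(\<integral>\<^sup>+ x. (\<integral>\<^sup>+ y. ennreal \<bar>u x - u y\<bar> * k (x - y) \<partial>lebesgue) \<partial>lebesgue) = energy k' u'"
proof -
  have inner: "(\<integral>\<^sup>+ y. ennreal \<bar>u x - u y\<bar> * k (x - y) \<partial>lborel)
      = (\<integral>\<^sup>+ z. ennreal \<bar>u' x - u' (x - z)\<bar> * k' z \<partial>lborel)" if "u x = u' x" for x
  proof -
    have "(\<integral>\<^sup>+ y. ennreal \<bar>u x - u y\<bar> * k (x - y) \<partial>lborel)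
        = (\<integral>\<^sup>+ y. ennreal \<bar>u' x - u' (x - (x - y))\<bar> * k' (x - y) \<partial>lborel)"
      using u AE_lborel_reflect[OF k, of x] that by (intro nn_integral_cong_AE) auto
    then show ?thesis
      using nn_integral_lborel_reflect[of "\<lambda>z. ennreal \<bar>u' x - u' (x - z)\<bar> * k' z" x] by simp
  qed
  have "(\<integral>\<^sup>+ x. (\<integral>\<^sup>+ y. ennreal \<bar>u x - u y\<bar> * k (x - y) \<partial>lborel) \<partial>lborel)
      = (\<integral>\<^sup>+ x. (\<integral>\<^sup>+ z. ennreal \<bar>u' x - u' (x - z)\<bar> * k' z \<partial>lborel) \<partial>lborel)"
    using u inner by (intro nn_integral_cong_AE) auto
  also have "\<dots> = (\<integral>\<^sup>+ z. (\<integral>\<^sup>+ x. ennreal \<bar>u' x - u' (x - z)\<bar> * k' z \<partial>lborel) \<partial>lborel)"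
    by (rule lborel_pair.Fubini') measurable
  also have "\<dots> = energy k' u'"
    unfolding energy_def increment_def by (simp add: nn_integral_multc mult.commute[of "k' _"])
  finally show ?thesis by (simp add: nn_integral_completion)
qed

lemma energy_mono_kernel: "(\<And>z. k z \<le> k' z) \<Longrightarrow> energy k u \<le> energy k' u"
  unfolding energy_def by (intro nn_integral_mono mult_right_mono) auto

text \<open>
  By the triangle inequality, since \<open>u x - v x\<close> and its translate have the same integral. With an
  integrable kernel this makes the energy Lipschitz in \<open>L\<^sup>1\<close>.
\<close>

lemma increment_le:
  fixes u v :: "'a::euclidean_space \<Rightarrow> real"
  assumes [measurable]: "u \<in> borel_measurable borel" "v \<in> borel_measurable borel"
  shows "increment u z \<le> increment v z + 2 * (\<integral>\<^sup>+ x. ennreal \<bar>u x - v x\<bar> \<partial>lborel)"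
proof -
  have "increment u z \<le> (\<integral>\<^sup>+ x. (ennreal \<bar>v x - v (x - z)\<bar> + ennreal \<bar>u x - v x\<bar>)
      + ennreal \<bar>u (x - z) - v (x - z)\<bar> \<partial>lborel)"
    unfolding increment_def by (intro nn_integral_mono) (simp flip: ennreal_plus)
  also have "\<dots> = increment v z + (\<integral>\<^sup>+ x. ennreal \<bar>u x - v x\<bar> \<partial>lborel)
       + (\<integral>\<^sup>+ x. ennreal \<bar>u (x - z) - v (x - z)\<bar> \<partial>lborel)"
    unfolding increment_def by (simp add: nn_integral_add)
  finally show ?thesis
    using nn_integral_lborel_translate[of "\<lambda>x. ennreal \<bar>u x - v x\<bar>" z]
    by (simp add: mult_2 add.assoc)
qed

lemma increment_le_integral:
  fixes u :: "'a::euclidean_space \<Rightarrow> real"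
  assumes "u \<in> borel_measurable borel"
  shows "increment u z \<le> 2 * (\<integral>\<^sup>+ x. ennreal \<bar>u x\<bar> \<partial>lborel)"
  using increment_le[OF assms, of "\<lambda>_. 0" z] by (simp add: increment_def)

section \<open>The coarea formula\<close>

lemma abs_diff_eq_integral_levels:
  fixes a b :: real
  assumes "0 \<le> a" "a \<le> 1" "0 \<le> b" "b \<le> 1"
  shows "ennreal \<bar>a - b\<bar>
    = (\<integral>\<^sup>+ t\<in>{0..1}. ennreal \<bar>indicat_real {t<..} a - indicat_real {t<..} b\<bar> \<partial>lborel)"
proof -
  have "(\<integral>\<^sup>+ t\<in>{0..1}. ennreal \<bar>indicat_real {t<..} a - indicat_real {t<..} b\<bar> \<partial>lborel)
      = (\<integral>\<^sup>+ t. indicator {min a b..<max a b} t \<partial>lborel)"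
    using assms by (intro nn_integral_cong) (auto simp: indicator_def min_def max_def)
  also have "\<dots> = ennreal \<bar>a - b\<bar>"
    by (simp add: min_def max_def abs_if)
  finally show ?thesis by simp
qed

text \<open>
  By the layer cake representation of \<open>|a - b|\<close> and Tonelli, the energy of \<open>v\<close> is the integral over
  \<open>t\<close> of the energies of the superlevel sets. If all of them with \<open>t\<close> in \<open>(\<theta>, 1 - \<theta>)\<close> were at least
  \<open>b\<close>, that integral would be at least \<open>b * (1 - 2 * \<theta>)\<close>.
\<close>

lemma coarea_level:
  fixes v :: "'a::euclidean_space \<Rightarrow> real" and k :: "'a \<Rightarrow> ennreal"
  assumes [measurable]: "v \<in> borel_measurable borel" "k \<in> borel_measurable borel"
    and v: "\<And>x. 0 \<le> v x" "\<And>x. v x \<le> 1"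
    and \<theta>: "0 \<le> \<theta>" "\<theta> \<le> 1/2"
    and less: "energy k v < b * ennreal (1 - 2 * \<theta>)"
  obtains t where "\<theta> < t" "t < 1 - \<theta>" "energy k (indicat_real {x. t < v x}) < b"
proof -
  have eq: "energy k v = (\<integral>\<^sup>+ t\<in>{0..1}. energy k (indicat_real {x. t < v x}) \<partial>lborel)"
  proof -
    have [simp]: "indicat_real {t<..} (v x) = indicat_real {x. t < v x} x" for t x
      by (simp add: indicator_def)
    let ?g = "\<lambda>t z x. k z * (ennreal \<bar>indicat_real {x. t < v x} x - indicat_real {x. t < v x} (x - z)\<bar>
          * indicator {0..1} (t::real))"
    have meas: "(\<lambda>(t, x). indicat_real {x. t < v x} x) \<in> borel_measurable (borel \<Otimes>\<^sub>M borel)"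
      unfolding indicator_def by measurable
    have m: "(\<lambda>p. indicat_real {x. f p < v x} (g p)) \<in> borel_measurable M"
      if "f \<in> borel_measurable M" "g \<in> borel_measurable M" for f :: "'c \<Rightarrow> real" and g M
      using measurable_compose[OF measurable_Pair[OF that] meas] by simp
    note m [measurable]
    have "energy k v = (\<integral>\<^sup>+ z. k z * (\<integral>\<^sup>+ x. (\<integral>\<^sup>+ t. ennreal \<bar>indicat_real {x. t < v x} x
       - indicat_real {x. t < v x} (x - z)\<bar> * indicator {0..1} t \<partial>lborel) \<partial>lborel) \<partial>lborel)"
      unfolding energy_def increment_def
      by (simp add: abs_diff_eq_integral_levels[OF v v])
    also have "\<dots> = (\<integral>\<^sup>+ z. k z * (\<integral>\<^sup>+ t. (\<integral>\<^sup>+ x. ennreal \<bar>indicat_real {x. t < v x} x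
       - indicat_real {x. t < v x} (x - z)\<bar> * indicator {0..1} t \<partial>lborel) \<partial>lborel) \<partial>lborel)"
      by (subst lborel_pair.Fubini') measurable
    also have "\<dots> = (\<integral>\<^sup>+ z. (\<integral>\<^sup>+ t. k z * (\<integral>\<^sup>+ x. ennreal \<bar>indicat_real {x. t < v x} x
       - indicat_real {x. t < v x} (x - z)\<bar> * indicator {0..1} t \<partial>lborel) \<partial>lborel) \<partial>lborel)"
      by (subst nn_integral_cmult) measurable
    also have "\<dots> = (\<integral>\<^sup>+ t. (\<integral>\<^sup>+ z. k z * (\<integral>\<^sup>+ x. ennreal \<bar>indicat_real {x. t < v x} x
       - indicat_real {x. t < v x} (x - z)\<bar> * indicator {0..1} t \<partial>lborel) \<partial>lborel) \<partial>lborel)"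
      by (rule lborel_pair.Fubini') measurable
    also have "\<dots> = (\<integral>\<^sup>+ t\<in>{0..1}. energy k (indicat_real {x. t < v x}) \<partial>lborel)"
      unfolding energy_def increment_def
      by (intro nn_integral_cong) (auto simp: indicator_def)
    finally show ?thesis .
  qed
  show ?thesis
  proof (rule ccontr)
    assume "\<not> thesis"
    with that have ge: "b \<le> energy k (indicat_real {x. t < v x})" if "\<theta> < t" "t < 1 - \<theta>" for t
      using \<open>\<theta> < t\<close> \<open>t < 1 - \<theta>\<close> not_le by blast
    have "b * ennreal (1 - 2 * \<theta>) = (\<integral>\<^sup>+ t. b * indicator {\<theta><..<1 - \<theta>} t \<partial>lborel)"
      using \<theta> by (simp add: nn_integral_cmult algebra_simps)
    also have "\<dots> \<le> energy k v"
      unfolding eq using ge \<theta> by (intro nn_integral_mono) (auto simp: indicator_def)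
    finally show False using less by simp
  qed
qed

section \<open>Cutting off at a large radius\<close>

text \<open>
  Dominated convergence, with the integrand for \<open>n = 0\<close> as the dominating function.
\<close>

lemma tendsto_truncated_integral:
  fixes f :: "'a::euclidean_space \<Rightarrow> ennreal"
  assumes [measurable]: "f \<in> borel_measurable borel"
    and fin: "(\<integral>\<^sup>+ z. f z * ennreal (min 1 (norm z)) \<partial>lborel) < \<infinity>"
  shows "(\<lambda>n. \<integral>\<^sup>+ z. f z * ennreal (min 1 (norm z / real (Suc n))) \<partial>lborel) \<longlonglongrightarrow> 0"
proof -
  have "(\<lambda>n. \<integral>\<^sup>+ z. f z * ennreal (min 1 (norm z / real (Suc n))) \<partial>lborel) \<longlonglongrightarrow> (\<integral>\<^sup>+ z. 0 \<partial>(lborel :: 'a measure))"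
  proof (rule nn_integral_dominated_convergence[where w = "\<lambda>z. f z * ennreal (min 1 (norm z))"])
    show "AE z in lborel. f z * ennreal (min 1 (norm z / real (Suc n))) \<le> f z * ennreal (min 1 (norm z))" for n
      by (intro always_eventually allI mult_left_mono ennreal_leI min.mono)
        (auto simp: field_simps mult_left_le)
    have "AE z in lborel. f z * ennreal (min 1 (norm z)) \<noteq> \<infinity>"
      by (rule nn_integral_noteq_infinite) (use fin in auto)
    then show "AE z in lborel. (\<lambda>n. f z * ennreal (min 1 (norm z / real (Suc n)))) \<longlonglongrightarrow> 0"
    proof eventually_elim
      case (elim z)
      show ?case
      proof (cases "z = 0")
        case False
        then have "f z < \<infinity>"
          using elim by (auto simp: ennreal_mult_eq_top_iff less_top[symmetric] min_def split: if_splits)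
        moreover have "(\<lambda>n. min 1 (norm z / real (Suc n))) \<longlonglongrightarrow> min 1 0"
          by (intro tendsto_min tendsto_const LIMSEQ_Suc[OF lim_const_over_n])
        ultimately show ?thesis
          using ennreal_tendsto_cmult[of "f z" "\<lambda>n. ennreal (min 1 (norm z / real (Suc n)))" 0]
          by (auto simp: ennreal_tendsto_0_iff)
      qed simp
    qed
  qed (use fin in auto)
  then show ?thesis by simp
qed

definition cutoff :: "real \<Rightarrow> 'a::euclidean_space \<Rightarrow> real" where
  "cutoff R x = max 0 (1 - norm x / R)"

lemma measurable_cutoff [measurable]: "cutoff R \<in> borel_measurable borel"
  unfolding cutoff_def by measurable

lemma cutoff_bounds: "0 \<le> cutoff R x" "R > 0 \<Longrightarrow> cutoff R x \<le> 1"
  by (auto simp: cutoff_def)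

lemma cutoff_diff_le:
  assumes "R > 0"
  shows "\<bar>cutoff R x - cutoff R (x - z)\<bar> \<le> min 1 (norm z / R)"
proof -
  have "\<bar>norm x - norm (x - z)\<bar> \<le> norm z"
    using norm_triangle_ineq3[of x "x - z"] by simp
  then have "\<bar>norm x / R - norm (x - z) / R\<bar> \<le> norm z / R"
    using assms by (simp add: divide_right_mono flip: diff_divide_distrib)
  then have "\<bar>cutoff R x - cutoff R (x - z)\<bar> \<le> norm z / R"
    unfolding cutoff_def by linarith
  moreover have "\<bar>cutoff R x - cutoff R (x - z)\<bar> \<le> 1"
    using cutoff_bounds(1)[of R x] cutoff_bounds(1)[of R "x - z"]
      cutoff_bounds(2)[of R x] cutoff_bounds(2)[of R "x - z"] assms by linarith
  ultimately show ?thesis by simp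
qed

text \<open>
  The difference of \<open>u * cutoff R\<close> at two points splits into a difference of \<open>u\<close>, multiplied by a
  cutoff that is at most \<open>1\<close>, and \<open>u\<close> times a difference of cutoffs, which is at most
  \<open>min 1 (|z| / R)\<close>. The error tends to \<open>0\<close> as \<open>R\<close> grows, by \<open>tendsto_truncated_integral\<close>.
\<close>

lemma energy_cutoff_le:
  fixes u :: "'a::euclidean_space \<Rightarrow> real"
  assumes [measurable]: "u \<in> borel_measurable borel" "k \<in> borel_measurable borel" and "R > 0"
  shows "energy k (\<lambda>x. u x * cutoff R x) \<le> energy k u
    + (\<integral>\<^sup>+ x. ennreal \<bar>u x\<bar> \<partial>lborel) * (\<integral>\<^sup>+ z. k z * ennreal (min 1 (norm z / R)) \<partial>lborel)"
proof -
  have "increment (\<lambda>x. u x * cutoff R x) z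
      \<le> increment u z + (\<integral>\<^sup>+ x. ennreal \<bar>u x\<bar> \<partial>lborel) * ennreal (min 1 (norm z / R))" for z
  proof -
    have "\<bar>u x * cutoff R x - u (x - z) * cutoff R (x - z)\<bar>
        \<le> \<bar>u x - u (x - z)\<bar> + \<bar>u x\<bar> * min 1 (norm z / R)" for x
    proof -
      have "u x * cutoff R x - u (x - z) * cutoff R (x - z)
          = u x * (cutoff R x - cutoff R (x - z)) + (u x - u (x - z)) * cutoff R (x - z)"
        by (simp add: algebra_simps)
      then have "\<bar>u x * cutoff R x - u (x - z) * cutoff R (x - z)\<bar>
          \<le> \<bar>u x\<bar> * \<bar>cutoff R x - cutoff R (x - z)\<bar> + \<bar>u x - u (x - z)\<bar> * \<bar>cutoff R (x - z)\<bar>"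
        using abs_triangle_ineq by (metis abs_mult)
      also have "\<dots> \<le> \<bar>u x\<bar> * min 1 (norm z / R) + \<bar>u x - u (x - z)\<bar> * 1"
        using cutoff_diff_le[OF \<open>R > 0\<close>] cutoff_bounds[of R "x - z"] \<open>R > 0\<close>
        by (intro add_mono mult_left_mono) auto
      finally show ?thesis by simp
    qed
    then have "increment (\<lambda>x. u x * cutoff R x) z
        \<le> (\<integral>\<^sup>+ x. ennreal \<bar>u x - u (x - z)\<bar> + ennreal \<bar>u x\<bar> * ennreal (min 1 (norm z / R)) \<partial>lborel)"
      unfolding increment_def using \<open>R > 0\<close>
      by (intro nn_integral_mono) (simp flip: ennreal_mult ennreal_plus)
    also have "\<dots> = increment u z + (\<integral>\<^sup>+ x. ennreal \<bar>u x\<bar> \<partial>lborel) * ennreal (min 1 (norm z / R))"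
      unfolding increment_def by (simp add: nn_integral_add nn_integral_multc)
    finally show ?thesis .
  qed
  then have "energy k (\<lambda>x. u x * cutoff R x)
     \<le> (\<integral>\<^sup>+ z. k z * increment u z
        + (\<integral>\<^sup>+ x. ennreal \<bar>u x\<bar> \<partial>lborel) * (k z * ennreal (min 1 (norm z / R))) \<partial>lborel)"
    unfolding energy_def
    by (intro nn_integral_mono) (metis (no_types, lifting) distrib_left mult.left_commute mult_left_mono zero_le)
  then show ?thesis
    unfolding energy_def by (simp add: nn_integral_add nn_integral_cmult)
qed

section \<open>Mollification\<close>

lemma ennreal_abs_integral_mult_le:
  fixes f g :: "'a \<Rightarrow> real"
  assumes "integrable M (\<lambda>y. f y * g y)" "\<And>y. 0 \<le> f y"
  shows "ennreal \<bar>LINT y|M. f y * g y\<bar> \<le> (\<integral>\<^sup>+ y. ennreal (f y) * ennreal \<bar>g y\<bar> \<partial>M)"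
  using integral_norm_bound_ennreal[OF assms(1)] assms(2) by (simp add: abs_mult ennreal_mult)

definition mollify :: "('a::euclidean_space \<Rightarrow> real) \<Rightarrow> ('a \<Rightarrow> real) \<Rightarrow> 'a \<Rightarrow> real" where
  "mollify \<eta> w x = (LINT y|lborel. \<eta> y * w (x - y))"

lemma measurable_mollify [measurable]:
  assumes [measurable]: "\<eta> \<in> borel_measurable borel" "w \<in> borel_measurable borel"
  shows "mollify \<eta> w \<in> borel_measurable borel"
  unfolding mollify_def by measurable

context
  fixes \<eta> w :: "'a::euclidean_space \<Rightarrow> real"
  assumes meas [measurable]: "\<eta> \<in> borel_measurable borel" "w \<in> borel_measurable borel"
    and \<eta>: "\<And>y. 0 \<le> \<eta> y" "(\<integral>\<^sup>+ y. ennreal (\<eta> y) \<partial>lborel) = 1"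
    and w: "\<And>x. 0 \<le> w x" "\<And>x. w x \<le> 1"
begin

lemma integrable_mollifier: "integrable lborel \<eta>"
  using \<eta> by (intro integrableI_nonneg) auto

lemma integral_mollifier: "integral\<^sup>L lborel \<eta> = 1"
  using \<eta> by (subst integral_eq_nn_integral) auto

lemma integrable_mollify: "integrable lborel (\<lambda>y. \<eta> y * w (x - y))"
  by (rule Bochner_Integration.integrable_bound[OF integrable_mollifier])
    (use \<eta> w in \<open>auto simp: abs_mult mult_left_le\<close>)

lemma mollify_bounds: "0 \<le> mollify \<eta> w x" "mollify \<eta> w x \<le> 1"
proof -
  show "0 \<le> mollify \<eta> w x"
    unfolding mollify_def using \<eta> w by (intro integral_nonneg_AE) auto
  have "mollify \<eta> w x \<le> integral\<^sup>L lborel \<eta>"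
    unfolding mollify_def
    by (intro integral_mono integrable_mollify integrable_mollifier) (use \<eta> w in \<open>auto simp: mult_left_le\<close>)
  then show "mollify \<eta> w x \<le> 1" by (simp add: integral_mollifier)
qed

text \<open>
  Mollification averages translates of \<open>w\<close>, all of which have the increments of \<open>w\<close>; hence it
  lowers every energy, whatever the kernel.
\<close>

lemma increment_mollify_le: "increment (mollify \<eta> w) z \<le> increment w z"
proof -
  have "ennreal \<bar>mollify \<eta> w x - mollify \<eta> w (x - z)\<bar>
      \<le> (\<integral>\<^sup>+ y. ennreal (\<eta> y) * ennreal \<bar>w (x - y) - w (x - y - z)\<bar> \<partial>lborel)" for x
  proof -
    have "mollify \<eta> w x - mollify \<eta> w (x - z) = (LINT y|lborel. \<eta> y * (w (x - y) - w (x - y - z)))"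
      unfolding mollify_def
      using Bochner_Integration.integral_diff[OF integrable_mollify[of x] integrable_mollify[of "x - z"]]
      by (simp add: algebra_simps)
    moreover have "integrable lborel (\<lambda>y. \<eta> y * (w (x - y) - w (x - y - z)))"
      using Bochner_Integration.integrable_diff[OF integrable_mollify[of x] integrable_mollify[of "x - z"]]
      by (simp add: algebra_simps)
    ultimately show ?thesis
      using ennreal_abs_integral_mult_le \<eta>(1) by metis
  qed
  then have "increment (mollify \<eta> w) z
     \<le> (\<integral>\<^sup>+ x. (\<integral>\<^sup>+ y. ennreal (\<eta> y) * ennreal \<bar>w (x - y) - w (x - y - z)\<bar> \<partial>lborel) \<partial>lborel)"
    unfolding increment_def by (intro nn_integral_mono)
  also have "\<dots> = (\<integral>\<^sup>+ y. (\<integral>\<^sup>+ x. ennreal (\<eta> y) * ennreal \<bar>w (x - y) - w (x - y - z)\<bar> \<partial>lborel) \<partial>lborel)"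
    by (rule lborel_pair.Fubini') measurable
  also have "\<dots> = (\<integral>\<^sup>+ y. ennreal (\<eta> y) * increment w z \<partial>lborel)"
    unfolding increment_def
    using nn_integral_lborel_translate[of "\<lambda>x. ennreal \<bar>w x - w (x - z)\<bar>"]
    by (simp add: nn_integral_cmult)
  finally show ?thesis by (simp add: nn_integral_multc \<eta>)
qed

text \<open>
  The distance of \<open>w\<close> from its mollification is an average of increments over small shifts. This is
  how finite energy yields a rate of approximation in \<open>average_increment_le\<close>.
\<close>

lemma mollify_diff_le:
  "(\<integral>\<^sup>+ x. ennreal \<bar>mollify \<eta> w x - w x\<bar> \<partial>lborel) \<le> (\<integral>\<^sup>+ y. ennreal (\<eta> y) * increment w y \<partial>lborel)"
proof -
  have "ennreal \<bar>mollify \<eta> w x - w x\<bar>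
      \<le> (\<integral>\<^sup>+ y. ennreal (\<eta> y) * ennreal \<bar>w x - w (x - y)\<bar> \<partial>lborel)" for x
  proof -
    have int: "integrable lborel (\<lambda>y. \<eta> y * w x)"
      using integrable_mollifier by simp
    have "mollify \<eta> w x - w x = (LINT y|lborel. \<eta> y * (w (x - y) - w x))"
      using Bochner_Integration.integral_diff[OF integrable_mollify[of x] int] integral_mollifier
      by (simp add: mollify_def right_diff_distrib)
    moreover have "integrable lborel (\<lambda>y. \<eta> y * (w (x - y) - w x))"
      using Bochner_Integration.integrable_diff[OF integrable_mollify[of x] int]
      by (simp add: right_diff_distrib)
    ultimately show ?thesis
      using ennreal_abs_integral_mult_le[of lborel \<eta> "\<lambda>y. w (x - y) - w x"] \<eta>(1)
      by (simp add: abs_minus_commute)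
  qed
  then have "(\<integral>\<^sup>+ x. ennreal \<bar>mollify \<eta> w x - w x\<bar> \<partial>lborel)
      \<le> (\<integral>\<^sup>+ x. (\<integral>\<^sup>+ y. ennreal (\<eta> y) * ennreal \<bar>w x - w (x - y)\<bar> \<partial>lborel) \<partial>lborel)"
    by (intro nn_integral_mono)
  also have "\<dots> = (\<integral>\<^sup>+ y. (\<integral>\<^sup>+ x. ennreal (\<eta> y) * ennreal \<bar>w x - w (x - y)\<bar> \<partial>lborel) \<partial>lborel)"
    by (rule lborel_pair.Fubini') measurable
  also have "\<dots> = (\<integral>\<^sup>+ y. ennreal (\<eta> y) * increment w y \<partial>lborel)"
    unfolding increment_def by (simp add: nn_integral_cmult)
  finally show ?thesis .
qed

lemma mollify_eq: "mollify \<eta> w x = (LINT y|lborel. \<eta> (x - y) * w y)"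
  unfolding mollify_def
  by (subst (2) lborel_distr_reflect[of x, symmetric], subst integral_distr) auto

text \<open>
  Shifting the mollifier instead of \<open>w\<close> transfers the regularity of \<open>\<eta>\<close> to the convolution; only
  the integral of \<open>w\<close> enters.
\<close>

lemma increment_mollify_le_mollifier:
  "increment (mollify \<eta> w) z \<le> (\<integral>\<^sup>+ x. ennreal (w x) \<partial>lborel) * increment \<eta> z"
proof -
  have int: "integrable lborel (\<lambda>y. \<eta> (x - y) * w y)" for x
    using integrable_mollify[of x]
    by (subst lborel_distr_reflect[of x, symmetric], subst integrable_distr_eq) auto
  have "ennreal \<bar>mollify \<eta> w x - mollify \<eta> w (x - z)\<bar>
      \<le> (\<integral>\<^sup>+ y. ennreal (w y) * ennreal \<bar>\<eta> (x - y) - \<eta> (x - y - z)\<bar> \<partial>lborel)" for x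
  proof -
    have "mollify \<eta> w x - mollify \<eta> w (x - z) = (LINT y|lborel. w y * (\<eta> (x - y) - \<eta> (x - y - z)))"
      unfolding mollify_eq
      using Bochner_Integration.integral_diff[OF int[of x] int[of "x - z"]]
      by (simp add: algebra_simps)
    moreover have "integrable lborel (\<lambda>y. w y * (\<eta> (x - y) - \<eta> (x - y - z)))"
      using Bochner_Integration.integrable_diff[OF int[of x] int[of "x - z"]]
      by (simp add: algebra_simps)
    ultimately show ?thesis
      using ennreal_abs_integral_mult_le w(1) by metis
  qed
  then have "increment (mollify \<eta> w) z
     \<le> (\<integral>\<^sup>+ x. (\<integral>\<^sup>+ y. ennreal (w y) * ennreal \<bar>\<eta> (x - y) - \<eta> (x - y - z)\<bar> \<partial>lborel) \<partial>lborel)"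
    unfolding increment_def by (intro nn_integral_mono)
  also have "\<dots> = (\<integral>\<^sup>+ y. (\<integral>\<^sup>+ x. ennreal (w y) * ennreal \<bar>\<eta> (x - y) - \<eta> (x - y - z)\<bar> \<partial>lborel) \<partial>lborel)"
    by (rule lborel_pair.Fubini') measurable
  also have "\<dots> = (\<integral>\<^sup>+ y. ennreal (w y) * increment \<eta> z \<partial>lborel)"
    unfolding increment_def
    using nn_integral_lborel_translate[of "\<lambda>x. ennreal \<bar>\<eta> x - \<eta> (x - z)\<bar>"]
    by (simp add: nn_integral_cmult)
  finally show ?thesis by (simp add: nn_integral_multc)
qed

lemma mollify_eq_0:
  assumes "\<And>y. norm y \<ge> \<delta> \<Longrightarrow> \<eta> y = 0" "\<And>y. norm y \<ge> R \<Longrightarrow> w y = 0" "norm x \<ge> R + \<delta>"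
  shows "mollify \<eta> w x = 0"
proof -
  have "\<eta> y * w (x - y) = 0" for y
  proof (cases "norm y \<ge> \<delta>")
    case False
    then have "norm (x - y) \<ge> R"
      using assms(3) norm_triangle_ineq2[of x y] by linarith
    then show ?thesis using assms by simp
  qed (use assms in simp)
  then show ?thesis by (simp only: mollify_def) simp
qed

end

section \<open>Averages over balls\<close>

definition ball_average :: "real \<Rightarrow> 'a::euclidean_space \<Rightarrow> real" where
  "ball_average \<delta> y = indicat_real (ball 0 \<delta>) y / measure lborel (ball 0 \<delta> :: 'a set)"

lemma measurable_ball_average [measurable]: "ball_average \<delta> \<in> borel_measurable borel"
  unfolding ball_average_def by (intro borel_measurable_divide borel_measurable_indicator) auto

lemma nn_integral_ball_average:
  assumes "\<delta> > 0"
  shows "(\<integral>\<^sup>+ y. ennreal (ball_average \<delta> y) \<partial>(lborel :: 'a::euclidean_space measure)) = 1"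
proof -
  have pos: "measure lborel (ball 0 \<delta> :: 'a set) > 0"
    using assms by (rule content_ball_pos)
  have "(\<integral>\<^sup>+ y. ennreal (ball_average \<delta> y) \<partial>(lborel :: 'a measure))
      = (\<integral>\<^sup>+ y. ennreal (1 / measure lborel (ball 0 \<delta> :: 'a set)) * indicator (ball 0 \<delta>) y \<partial>(lborel :: 'a measure))"
    by (intro nn_integral_cong) (auto simp: ball_average_def indicator_def)
  also have "\<dots> = ennreal (1 / measure lborel (ball 0 \<delta> :: 'a set)) * emeasure lborel (ball 0 \<delta> :: 'a set)"
    by (simp add: nn_integral_cmult_indicator)
  also have "\<dots> = 1"
    using pos emeasure_lborel_ball_finite[of "0 :: 'a" \<delta>]
    by (subst emeasure_eq_ennreal_measure) (auto simp flip: ennreal_mult)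
  finally show ?thesis .
qed

text \<open>
  The indicators of a ball of radius \<open>\<delta>\<close> and of its translate by \<open>z\<close> differ only within two shells
  of thickness \<open>|z|\<close>, whose volume is controlled by Bernoulli's inequality.
\<close>

lemma increment_ball_average_le:
  assumes "\<delta> > 0"
  shows "increment (ball_average \<delta>) (z :: 'a::euclidean_space) \<le> ennreal (2 * real DIM('a) / \<delta> * norm z)"
proof -
  define c where "c = measure lborel (ball 0 \<delta> :: 'a set)"
  have c: "c > 0" using assms unfolding c_def by (rule content_ball_pos)
  define A where "A = ball (0 :: 'a) \<delta> - ball 0 (\<delta> - norm z)"
  have [measurable]: "A \<in> sets borel" by (simp add: A_def)
  have "ennreal \<bar>ball_average \<delta> x - ball_average \<delta> (x - z)\<bar>
      \<le> ennreal (1 / c) * indicator A x + ennreal (1 / c) * indicator A (x - z)" for x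
    using norm_triangle_ineq2[of x z] norm_triangle_sub[of x z] norm_triangle_ineq2[of "x - z" "-z"] c
    by (auto simp: ball_average_def A_def indicator_def c_def[symmetric])
  then have "increment (ball_average \<delta>) z
      \<le> (\<integral>\<^sup>+ x. ennreal (1 / c) * indicator A x + ennreal (1 / c) * indicator A (x - z) \<partial>lborel)"
    unfolding increment_def by (intro nn_integral_mono)
  also have "\<dots> = ennreal (1 / c) * emeasure lborel A
      + ennreal (1 / c) * (\<integral>\<^sup>+ x. indicator A (x - z) \<partial>lborel)"
    by (simp add: nn_integral_add nn_integral_cmult)
  also have "(\<integral>\<^sup>+ x. indicator A (x - z) \<partial>lborel) = emeasure lborel A"
    using nn_integral_lborel_translate[of "indicator A" z] by simp
  also have "emeasure lborel A \<le> ennreal (c * (real DIM('a) / \<delta> * norm z))"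
  proof -
    define r where "r = max 0 (\<delta> - norm z)"
    have r: "0 \<le> r" "r \<le> \<delta>" using assms by (auto simp: r_def)
    have A: "A = ball 0 \<delta> - ball 0 r" by (auto simp: A_def r_def less_max_iff_disj)
    have "emeasure lborel A = emeasure lborel (ball 0 \<delta> :: 'a set) - emeasure lborel (ball 0 r :: 'a set)"
      unfolding A using r emeasure_lborel_ball_finite[of "0 :: 'a" r]
      by (intro emeasure_Diff) (auto intro: subset_ball)
    also have "\<dots> = ennreal (c - measure lborel (ball 0 r :: 'a set))"
      unfolding c_def using emeasure_lborel_ball_finite[of "0 :: 'a" r] emeasure_lborel_ball_finite[of "0 :: 'a" \<delta>]
      by (subst (1 2) emeasure_eq_ennreal_measure) (auto simp: ennreal_minus)
    also have "c - measure lborel (ball 0 r :: 'a set) = c * (1 - (r / \<delta>) ^ DIM('a))"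
      using r assms by (simp add: c_def content_ball power_divide field_simps)
    also have "\<dots> \<le> c * (real DIM('a) / \<delta> * norm z)"
    proof (rule mult_left_mono)
      have "1 + real DIM('a) * (r / \<delta> - 1) \<le> (1 + (r / \<delta> - 1)) ^ DIM('a)"
        using r assms by (intro Bernoulli_inequality) (auto simp: field_simps)
      moreover have "1 - r / \<delta> \<le> norm z / \<delta>"
        using assms by (auto simp: r_def field_simps max_def)
      then have "real DIM('a) * (1 - r / \<delta>) \<le> real DIM('a) * (norm z / \<delta>)"
        by (intro mult_left_mono) auto
      ultimately show "1 - (r / \<delta>) ^ DIM('a) \<le> real DIM('a) / \<delta> * norm z"
        by (simp add: algebra_simps)
    qed (use c in simp)
    finally show ?thesis by (simp add: ennreal_leI)
  qed
  finally have "increment (ball_average \<delta>) z \<le> ennreal (1 / c) * ennreal (c * (real DIM('a) / \<delta> * norm z))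
     + ennreal (1 / c) * ennreal (c * (real DIM('a) / \<delta> * norm z))"
    by (meson add_mono mult_left_mono order_trans zero_le)
  also have "\<dots> = ennreal (2 * real DIM('a) / \<delta> * norm z)"
    using c assms by (simp add: field_simps flip: ennreal_mult ennreal_plus)
  finally show ?thesis .
qed

section \<open>The fractional kernel and approximation in energy\<close>

text \<open>
  At the origin the value is \<open>0\<close>, since \<open>1 / 0 = 0\<close>; lower bounds therefore exclude \<open>z = 0\<close>.
\<close>

definition riesz_kernel :: "real \<Rightarrow> 'a::euclidean_space \<Rightarrow> ennreal" where
  "riesz_kernel \<alpha> z = ennreal (1 / norm z powr (real DIM('a) + \<alpha>))"

lemma measurable_riesz_kernel [measurable]: "riesz_kernel \<alpha> \<in> borel_measurable borel"
  unfolding riesz_kernel_def by measurable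

lemma riesz_kernel_ge:
  fixes z :: "'a::euclidean_space"
  assumes "\<alpha> > 0" "norm z \<le> r" "z \<noteq> 0"
  shows "ennreal (1 / r powr (real DIM('a) + \<alpha>)) \<le> riesz_kernel \<alpha> z"
  unfolding riesz_kernel_def
  using assms by (intro ennreal_leI divide_left_mono powr_mono2 mult_pos_pos) auto

text \<open>
  On the ball of radius \<open>\<delta>\<close> the density \<open>1 / (\<omega> \<delta>\<^sup>d)\<close> of the average is at most
  \<open>\<delta>\<^sup>\<alpha> / \<omega>\<close> times the kernel, where \<open>\<omega>\<close> is the volume of the unit ball. Together with
  \<open>mollify_diff_le\<close> this bounds the \<open>L\<^sup>1\<close> error of the averaging by \<open>\<delta>\<^sup>\<alpha>\<close> times the energy.
\<close>

lemma average_increment_le: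
  fixes w :: "'a::euclidean_space \<Rightarrow> real"
  assumes "\<alpha> > 0" "\<delta> > 0" and [measurable]: "w \<in> borel_measurable borel"
  shows "(\<integral>\<^sup>+ y. ennreal (ball_average \<delta> y) * increment w y \<partial>lborel)
    \<le> ennreal (\<delta> powr \<alpha> / unit_ball_vol DIM('a)) * energy (riesz_kernel \<alpha>) w"
proof -
  define c where "c = \<delta> powr \<alpha> / unit_ball_vol DIM('a)"
  have c: "c \<ge> 0" by (simp add: c_def)
  have "ennreal (ball_average \<delta> y) * increment w y \<le> ennreal c * (riesz_kernel \<alpha> y * increment w y)" for y
  proof (cases "y \<noteq> 0 \<and> norm y < \<delta>")
    case True
    have "ball_average \<delta> y = c * (1 / \<delta> powr (real DIM('a) + \<alpha>))"
      using True \<open>\<delta> > 0\<close>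
      by (simp add: ball_average_def c_def content_ball powr_add powr_realpow)
    then have "ennreal (ball_average \<delta> y) = ennreal c * ennreal (1 / \<delta> powr (real DIM('a) + \<alpha>))"
      using c by (subst ennreal_mult[symmetric]) auto
    also have "\<dots> \<le> ennreal c * riesz_kernel \<alpha> y"
      using True \<open>\<alpha> > 0\<close> by (intro mult_left_mono riesz_kernel_ge) auto
    finally show ?thesis
      by (metis mult.assoc mult_right_mono zero_le)
  qed (auto simp: ball_average_def increment_def)
  then have "(\<integral>\<^sup>+ y. ennreal (ball_average \<delta> y) * increment w y \<partial>lborel)
     \<le> (\<integral>\<^sup>+ y. ennreal c * (riesz_kernel \<alpha> y * increment w y) \<partial>lborel)"
    by (intro nn_integral_mono)
  then show ?thesis
    unfolding energy_def c_def by (simp add: nn_integral_cmult)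
qed

text \<open>
  Cut off at a large radius, then average over small balls. The cutoff needs finite measure and the
  weighted integrability of the kernel; the averaging does not raise the energy. The bound on the
  increments of \<open>v\<close> combines the trivial one, twice the integral, with the Lipschitz bound
  inherited from the ball average.
\<close>

lemma approximate_by_bounded_lipschitz:
  fixes E :: "'a::euclidean_space set"
  assumes \<alpha>: "\<alpha> > 0" and [measurable]: "E \<in> sets borel"
    and E: "emeasure lborel E < \<infinity>" "energy (riesz_kernel \<alpha>) (indicat_real E) < \<infinity>"
    and k: "(\<integral>\<^sup>+ z. riesz_kernel \<alpha> z * ennreal (min 1 (norm (z :: 'a))) \<partial>lborel) < \<infinity>"
    and e: "e > 0"
  obtains v R C where "v \<in> borel_measurable borel" "\<And>x. 0 \<le> v x" "\<And>x. v x \<le> 1"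
    "\<And>x. norm x \<ge> R \<Longrightarrow> v x = 0" "C \<ge> 0"
    "\<And>z. increment v z \<le> ennreal (C * min 1 (norm z))"
    "(\<integral>\<^sup>+ x. ennreal \<bar>v x - indicat_real E x\<bar> \<partial>lborel) \<le> ennreal e"
    "energy (riesz_kernel \<alpha>) v \<le> energy (riesz_kernel \<alpha>) (indicat_real E) + ennreal e"
proof -
  let ?k = "riesz_kernel \<alpha> :: 'a \<Rightarrow> ennreal" and ?u = "indicat_real E"
  define m where "m = measure lborel E"
  have m: "(\<integral>\<^sup>+ x. ennreal \<bar>?u x\<bar> \<partial>lborel) = ennreal m" "m \<ge> 0"
    using E(1) by (simp_all add: m_def ennreal_indicator emeasure_eq_ennreal_measure)
  have "(\<lambda>n. ennreal m * (\<integral>\<^sup>+ z. ?k z * ennreal (min 1 (norm z / real (Suc n))) \<partial>lborel)) \<longlonglongrightarrow> ennreal m * 0"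
    by (intro ennreal_tendsto_cmult tendsto_truncated_integral) (use k in auto)
  then have "\<forall>\<^sub>F n in sequentially.
      ennreal m * (\<integral>\<^sup>+ z. ?k z * ennreal (min 1 (norm z / real (Suc n))) \<partial>lborel) < ennreal e"
    by (rule order_tendstoD(2)) (use e in simp)
  moreover have "\<forall>\<^sub>F n in sequentially.
      (\<integral>\<^sup>+ x. ennreal \<bar>?u x\<bar> * ennreal (min 1 (norm x / real (Suc n))) \<partial>lborel) < ennreal (e / 2)"
  proof (rule order_tendstoD(2)[OF tendsto_truncated_integral])
    have "(\<integral>\<^sup>+ x. ennreal \<bar>?u x\<bar> * ennreal (min 1 (norm x)) \<partial>lborel) \<le> (\<integral>\<^sup>+ x. ennreal \<bar>?u x\<bar> * 1 \<partial>lborel)"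
      by (intro nn_integral_mono mult_left_mono) auto
    then show "(\<integral>\<^sup>+ x. ennreal \<bar>?u x\<bar> * ennreal (min 1 (norm x)) \<partial>lborel) < \<infinity>"
      using m by (simp add: le_less_trans)
  qed (use e in auto)
  ultimately have "\<forall>\<^sub>F n in sequentially.
      ennreal m * (\<integral>\<^sup>+ z. ?k z * ennreal (min 1 (norm z / real (Suc n))) \<partial>lborel) < ennreal e \<and>
      (\<integral>\<^sup>+ x. ennreal \<bar>?u x\<bar> * ennreal (min 1 (norm x / real (Suc n))) \<partial>lborel) < ennreal (e / 2)"
    by eventually_elim simp
  from eventually_happens'[OF sequentially_bot this] obtain n where
    n: "ennreal m * (\<integral>\<^sup>+ z. ?k z * ennreal (min 1 (norm z / real (Suc n))) \<partial>lborel) < ennreal e"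
      "(\<integral>\<^sup>+ x. ennreal \<bar>?u x\<bar> * ennreal (min 1 (norm x / real (Suc n))) \<partial>lborel) < ennreal (e / 2)"
    by auto
  define R where "R = real (Suc n)"
  have R: "R > 0" by (simp add: R_def)
  define w where "w = (\<lambda>x. ?u x * cutoff R x)"
  have w_meas [measurable]: "w \<in> borel_measurable borel" unfolding w_def by measurable
  have w: "0 \<le> w x" "w x \<le> 1" for x
    using cutoff_bounds[of R x] R by (auto simp: w_def indicator_def)
  have w0: "w x = 0" if "norm x \<ge> R" for x
    using that R by (simp add: w_def cutoff_def)
  have w_energy: "energy ?k w \<le> energy ?k ?u + ennreal e"
  proof -
    have "energy ?k w \<le> energy ?k ?u + ennreal m * (\<integral>\<^sup>+ z. ?k z * ennreal (min 1 (norm z / R)) \<partial>lborel)"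
      unfolding w_def m(1)[symmetric] by (rule energy_cutoff_le[OF _ _ R]) measurable
    also have "\<dots> \<le> energy ?k ?u + ennreal e"
      using n(1) unfolding R_def by (intro add_left_mono less_imp_le)
    finally show ?thesis .
  qed
  have w_close: "(\<integral>\<^sup>+ x. ennreal \<bar>w x - ?u x\<bar> \<partial>lborel) \<le> ennreal (e / 2)"
  proof -
    have "ennreal \<bar>w x - ?u x\<bar> \<le> ennreal \<bar>?u x\<bar> * ennreal (min 1 (norm x / R))" for x
      using R by (auto simp: w_def cutoff_def indicator_def)
    then have "(\<integral>\<^sup>+ x. ennreal \<bar>w x - ?u x\<bar> \<partial>lborel)
        \<le> (\<integral>\<^sup>+ x. ennreal \<bar>?u x\<bar> * ennreal (min 1 (norm x / R)) \<partial>lborel)"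
      by (intro nn_integral_mono)
    then show ?thesis using n(2) by (simp add: R_def)
  qed
  have "energy ?k w < \<infinity>" using w_energy E(2) by (simp add: order_le_less_trans)
  then obtain P where P: "energy ?k w = ennreal P" "P \<ge> 0"
    by (cases "energy ?k w") auto
  have w_int: "(\<integral>\<^sup>+ x. ennreal (w x) \<partial>lborel) \<le> ennreal m"
    unfolding m(1)[symmetric] using w cutoff_bounds(2)[OF R]
    by (intro nn_integral_mono ennreal_leI) (auto simp: w_def indicator_def)
  \<comment> \<open>a radius for which the bound \<open>\<delta>\<^sup>\<alpha> P / \<omega>\<close> on the averaged increment is at most \<open>e / 2\<close>\<close>
  define \<omega> where "\<omega> = unit_ball_vol DIM('a)"
  have \<omega>: "\<omega> > 0" by (simp add: \<omega>_def)
  define \<delta> where "\<delta> = (e / 2 * \<omega> / (P + 1)) powr (1 / \<alpha>)"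
  have \<delta>: "\<delta> > 0" using e \<omega> P by (simp add: \<delta>_def)
  have \<delta>\<alpha>: "\<delta> powr \<alpha> = e / 2 * \<omega> / (P + 1)"
    using e \<omega> P \<alpha> by (simp add: \<delta>_def powr_powr)
  let ?\<eta> = "ball_average \<delta> :: 'a \<Rightarrow> real"
  have \<eta>: "?\<eta> \<in> borel_measurable borel" "\<And>y. 0 \<le> ?\<eta> y" "(\<integral>\<^sup>+ y. ennreal (?\<eta> y) \<partial>lborel) = 1"
    using nn_integral_ball_average[OF \<delta>] by (simp_all add: ball_average_def[of \<delta>])
  note mol = \<eta>(1) w_meas \<eta>(2,3) w
  define v where "v = mollify ?\<eta> w"
  \<comment> \<open>the first entry serves \<open>|z| \<ge> 1\<close>, the second \<open>|z| \<le> 1\<close>\<close>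
  define C where "C = max (2 * m) (m * (2 * real DIM('a) / \<delta>))"
  show ?thesis
  proof
    show "v \<in> borel_measurable borel" unfolding v_def by measurable
    show "0 \<le> v x" "v x \<le> 1" for x
      unfolding v_def by (rule mollify_bounds[OF mol])+
    show "v x = 0" if "norm x \<ge> R + \<delta>" for x
      unfolding v_def
      by (rule mollify_eq_0[OF mol, where R = R and \<delta> = \<delta>]) (use w0 that in \<open>auto simp: ball_average_def\<close>)
    show "C \<ge> 0" using m by (simp add: C_def)
    show "increment v z \<le> ennreal (C * min 1 (norm z))" for z
    proof -
      have "increment v z \<le> increment w z"
        unfolding v_def by (rule increment_mollify_le[OF mol])
      also have "\<dots> \<le> 2 * (\<integral>\<^sup>+ x. ennreal \<bar>w x\<bar> \<partial>lborel)"
        by (rule increment_le_integral) measurable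
      also have "\<dots> \<le> 2 * ennreal m"
        using w w_int by (intro mult_left_mono) auto
      also have "2 * ennreal m = ennreal (2 * m)"
        using m by (simp add: ennreal_mult)
      finally have 1: "increment v z \<le> ennreal (2 * m)" .
      have "increment v z \<le> (\<integral>\<^sup>+ x. ennreal (w x) \<partial>lborel) * increment ?\<eta> z"
        unfolding v_def by (rule increment_mollify_le_mollifier[OF mol])
      also have "\<dots> \<le> ennreal m * ennreal (2 * real DIM('a) / \<delta> * norm z)"
        by (intro mult_mono w_int increment_ball_average_le \<delta>) auto
      finally have 2: "increment v z \<le> ennreal (m * (2 * real DIM('a) / \<delta>) * norm z)"
        using m \<delta> by (simp add: mult.assoc flip: ennreal_mult)
      show ?thesis
      proof (cases "norm z \<le> 1")
        case True
        moreover have "m * (2 * real DIM('a) / \<delta>) * norm z \<le> C * norm z"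
          by (rule mult_right_mono) (simp_all only: C_def max.cobounded2 norm_ge_zero)
        ultimately have "m * (2 * real DIM('a) / \<delta>) * norm z \<le> C * min 1 (norm z)" by simp
        then show ?thesis using 2 by (meson ennreal_leI order_trans)
      next
        case False
        then have "2 * m \<le> C * min 1 (norm z)" by (simp add: C_def)
        then show ?thesis using 1 by (meson ennreal_leI order_trans)
      qed
    qed
    show "(\<integral>\<^sup>+ x. ennreal \<bar>v x - ?u x\<bar> \<partial>lborel) \<le> ennreal e"
    proof -
      have "(\<integral>\<^sup>+ x. ennreal \<bar>v x - w x\<bar> \<partial>lborel) \<le> ennreal (\<delta> powr \<alpha> / \<omega>) * energy ?k w"
        using mollify_diff_le[OF mol] average_increment_le[OF \<alpha> \<delta>, of w]
        unfolding v_def \<omega>_def by (auto intro: order_trans)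
      also have "\<dots> = ennreal (\<delta> powr \<alpha> / \<omega> * P)"
        unfolding P(1) using P(2) \<omega> by (subst ennreal_mult[symmetric]) auto
      also have "\<dots> \<le> ennreal (e / 2)"
      proof (rule ennreal_leI)
        have "\<delta> powr \<alpha> / \<omega> * P = e / 2 * (P / (P + 1))"
          using \<omega> by (simp add: \<delta>\<alpha>)
        also have "\<dots> \<le> e / 2 * 1"
          using P e by (intro mult_left_mono) auto
        finally show "\<delta> powr \<alpha> / \<omega> * P \<le> e / 2" by simp
      qed
      finally have vw: "(\<integral>\<^sup>+ x. ennreal \<bar>v x - w x\<bar> \<partial>lborel) \<le> ennreal (e / 2)" .
      have "(\<integral>\<^sup>+ x. ennreal \<bar>v x - ?u x\<bar> \<partial>lborel)
          \<le> (\<integral>\<^sup>+ x. ennreal \<bar>v x - w x\<bar> + ennreal \<bar>w x - ?u x\<bar> \<partial>lborel)"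
        by (intro nn_integral_mono) (simp flip: ennreal_plus)
      also have "\<dots> = (\<integral>\<^sup>+ x. ennreal \<bar>v x - w x\<bar> \<partial>lborel) + (\<integral>\<^sup>+ x. ennreal \<bar>w x - ?u x\<bar> \<partial>lborel)"
        unfolding v_def by (intro nn_integral_add) measurable
      also have "\<dots> \<le> ennreal (e / 2) + ennreal (e / 2)"
        using vw w_close by (rule add_mono)
      finally show ?thesis using e by (simp flip: ennreal_plus)
    qed
    have "energy ?k v \<le> energy ?k w"
      unfolding energy_def v_def
      by (intro nn_integral_mono mult_left_mono increment_mollify_le[OF mol]) auto
    then show "energy ?k v \<le> energy ?k ?u + ennreal e"
      using w_energy by (rule order_trans)
  qed
qed

section \<open>Sets of finite fractional perimeter\<close>

lemma energy_Compl: "energy k (indicat_real (- E)) = energy k (indicat_real E)"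
proof -
  have "\<bar>indicat_real (- E) x - indicat_real (- E) y\<bar> = \<bar>indicat_real E x - indicat_real E y\<bar>" for x y :: 'a
    by (auto simp: indicator_def)
  then show ?thesis by (simp add: energy_def increment_def)
qed

text \<open>
  Lower semicontinuity: by continuity from below a slightly smaller ball still carries more than
  \<open>c\<close>, and it is contained in all balls of radius \<open>r\<close> with nearby centres.
\<close>

lemma open_emeasure_Int_ball_gt:
  fixes A :: "'a::euclidean_space set"
  assumes [measurable]: "A \<in> sets borel"
  shows "open {x. c < emeasure lborel (A \<inter> ball x r)}"
proof (rule openI)
  fix x assume "x \<in> {x. c < emeasure lborel (A \<inter> ball x r)}"
  then have c: "c < emeasure lborel (A \<inter> ball x r)" by simp
  let ?B = "\<lambda>n. A \<inter> ball x (r - 1 / real (Suc n))"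
  have UN: "(\<Union>n. ?B n) = A \<inter> ball x r"
  proof safe
    fix y assume "y \<in> A" "y \<in> ball x r"
    then obtain n where "1 / real (Suc n) < r - dist x y"
      using nat_approx_posE[of "r - dist x y"] by auto
    then show "y \<in> (\<Union>n. ?B n)" using \<open>y \<in> A\<close> by (auto intro!: exI[of _ n])
  next
    fix n y assume "y \<in> ball x (r - 1 / real (Suc n))"
    moreover have "1 / real (Suc n) > 0" by simp
    ultimately show "y \<in> ball x r" unfolding mem_ball by linarith
  qed
  have "incseq ?B"
    by (intro incseq_SucI Int_mono order_refl subset_ball) (simp add: frac_le)
  then have "(SUP n. emeasure lborel (?B n)) = emeasure lborel (A \<inter> ball x r)"
    unfolding UN[symmetric] by (intro SUP_emeasure_incseq) auto
  then obtain n where n: "c < emeasure lborel (?B n)"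
    using c by (auto simp: less_SUP_iff simp flip: \<open>_ = emeasure lborel (A \<inter> ball x r)\<close>)
  have "ball x (1 / real (Suc n)) \<subseteq> {x. c < emeasure lborel (A \<inter> ball x r)}"
  proof
    fix y assume y: "y \<in> ball x (1 / real (Suc n))"
    have "ball x (r - 1 / real (Suc n)) \<subseteq> ball y r"
    proof
      fix w assume "w \<in> ball x (r - 1 / real (Suc n))"
      then show "w \<in> ball y r"
        using y dist_triangle[of y w x] by (simp add: dist_commute)
    qed
    then have "emeasure lborel (?B n) \<le> emeasure lborel (A \<inter> ball y r)"
      by (intro emeasure_mono) auto
    then show "y \<in> {x. c < emeasure lborel (A \<inter> ball x r)}" using n by simp
  qed
  then show "\<exists>e>0. ball x e \<subseteq> {x. c < emeasure lborel (A \<inter> ball x r)}"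
    by (intro exI[of _ "1 / real (Suc n)"]) simp
qed

text \<open>
  Keeping only the pairs \<open>x \<in> F\<close>, \<open>y \<in> ball x r - E\<close>, for which the kernel is at least
  \<open>1 / r\<^sup>d\<^sup>+\<^sup>\<alpha>\<close>.
\<close>

lemma riesz_energy_ge:
  fixes E F :: "'a::euclidean_space set"
  assumes \<alpha>: "\<alpha> > 0" and [measurable]: "E \<in> sets borel" "F \<in> sets borel"
    and F: "F \<subseteq> E" "\<And>x. x \<in> F \<Longrightarrow> b \<le> emeasure lborel (ball x r - E)"
  shows "ennreal (1 / r powr (real DIM('a) + \<alpha>)) * b * emeasure lborel F
    \<le> energy (riesz_kernel \<alpha>) (indicat_real E)"
proof -
  let ?m = "ennreal (1 / r powr (real DIM('a) + \<alpha>))"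
  have "?m * b * emeasure lborel F = (\<integral>\<^sup>+ x. ?m * b * indicator F x \<partial>lborel)"
    by (simp add: nn_integral_cmult_indicator)
  also have "\<dots> \<le> (\<integral>\<^sup>+ x. (\<integral>\<^sup>+ y. ennreal \<bar>indicat_real E x - indicat_real E y\<bar>
      * riesz_kernel \<alpha> (x - y) \<partial>lborel) \<partial>lborel)"
  proof (intro nn_integral_mono)
    fix x :: 'a
    show "?m * b * indicator F x \<le> (\<integral>\<^sup>+ y. ennreal \<bar>indicat_real E x - indicat_real E y\<bar>
        * riesz_kernel \<alpha> (x - y) \<partial>lborel)"
    proof (cases "x \<in> F")
      case True
      then have "?m * b \<le> ?m * emeasure lborel (ball x r - E)"
        using F by (intro mult_left_mono) auto
      also have "\<dots> = (\<integral>\<^sup>+ y. ?m * indicator (ball x r - E) y \<partial>lborel)"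
        by (simp add: nn_integral_cmult_indicator)
      also have "\<dots> \<le> (\<integral>\<^sup>+ y. ennreal \<bar>indicat_real E x - indicat_real E y\<bar>
          * riesz_kernel \<alpha> (x - y) \<partial>lborel)"
      proof (intro nn_integral_mono)
        fix y :: 'a
        show "?m * indicator (ball x r - E) y \<le> ennreal \<bar>indicat_real E x - indicat_real E y\<bar> * riesz_kernel \<alpha> (x - y)"
        proof (cases "y \<in> ball x r - E")
          case inside: True
          then have "norm (x - y) \<le> r" "x - y \<noteq> 0"
            using True F(1) by (auto simp: dist_norm)
          then show ?thesis
            using riesz_kernel_ge[OF \<alpha>, of "x - y" r] inside True F(1) by auto
        qed simp
      qed
      finally show ?thesis using True by simp
    qed simp
  qed
  also have "\<dots> = energy (riesz_kernel \<alpha>) (indicat_real E)"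
    using double_integral_eq_energy[of "riesz_kernel \<alpha>" "indicat_real E" "riesz_kernel \<alpha>" "indicat_real E"]
    by (simp add: nn_integral_completion)
  finally show ?thesis .
qed

lemma finite_measure_if_complement_thick:
  fixes E :: "'a::euclidean_space set"
  assumes \<alpha>: "\<alpha> > 0" and [measurable]: "E \<in> sets borel"
    and fin: "energy (riesz_kernel \<alpha>) (indicat_real E) < \<infinity>"
    and "r > 0" "b > 0" and thick: "\<And>x. b \<le> emeasure lborel (ball x r - E)"
  shows "emeasure lborel E < \<infinity>"
proof -
  have "ennreal (1 / r powr (real DIM('a) + \<alpha>)) * b * emeasure lborel E < \<infinity>"
    using riesz_energy_ge[OF \<alpha>, of E E b r] thick fin by (auto simp: order_le_less_trans)
  then show ?thesis
    using \<open>r > 0\<close> \<open>b > 0\<close> by (auto simp: ennreal_mult_less_top)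
qed

text \<open>
  A ball of radius \<open>r\<close> that \<open>E\<close> fills exactly to one half costs an energy of order
  \<open>r\<^sup>d\<^sup>-\<^sup>\<alpha>\<close>, which for large \<open>r\<close> exceeds the finite energy of \<open>E\<close>; this uses \<open>\<alpha> < 1 \<le> d\<close>. At
  such a scale every centre \<open>x\<close> belongs to exactly one of two open sets, according to whether \<open>E\<close> or
  its complement fills more than half of \<open>ball x r\<close>. By connectedness the same alternative holds at
  all centres, and then \<open>finite_measure_if_complement_thick\<close> applies to \<open>E\<close> or to its complement.
\<close>

lemma finite_or_cofinite_measure:
  fixes E :: "'a::euclidean_space set"
  assumes \<alpha>: "0 < \<alpha>" "\<alpha> < 1" and [measurable]: "E \<in> sets borel"
    and fin: "energy (riesz_kernel \<alpha>) (indicat_real E) < \<infinity>"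
  shows "emeasure lborel E < \<infinity> \<or> emeasure lborel (- E) < \<infinity>"
proof -
  obtain p where p: "energy (riesz_kernel \<alpha>) (indicat_real E) = ennreal p" "p \<ge> 0"
    using fin by (cases "energy (riesz_kernel \<alpha>) (indicat_real E)") auto
  define d where "d = real DIM('a)"
  have d: "d \<ge> 1" unfolding d_def using DIM_positive[where 'a='a] by linarith
  define \<omega> where "\<omega> = unit_ball_vol d"
  have \<omega>: "\<omega> > 0" by (simp add: \<omega>_def d_def)
  \<comment> \<open>at this scale the perimeter bound excludes a ball in which \<open>E\<close> has density one half\<close>
  define q where "q = 4 * p * 2 powr (d + \<alpha>) / \<omega>\<^sup>2 + 1"
  have q: "q > 0" using p by (simp add: q_def add_nonneg_pos)
  define r where "r = q powr (1 / (d - \<alpha>))"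
  have r: "r > 0" using q by (simp add: r_def)
  have rq: "r powr (d - \<alpha>) = q" using q d \<alpha> by (simp add: r_def powr_powr)
  define h where "h = \<omega> * r powr d / 2"
  have h: "h > 0" using \<omega> r by (simp add: h_def)
  have vol: "emeasure lborel (ball x r) = ennreal (2 * h)" for x :: 'a
    using r by (simp add: emeasure_ball h_def \<omega>_def d_def powr_realpow)
  have split: "emeasure lborel (E \<inter> ball x r) + emeasure lborel (- E \<inter> ball x r) = ennreal (2 * h)" for x
    unfolding vol[of x, symmetric] by (subst plus_emeasure) (auto intro: arg_cong[where f = "emeasure lborel"])
  define U1 where "U1 = {x. ennreal h < emeasure lborel (E \<inter> ball x r)}"
  define U2 where "U2 = {x. ennreal h < emeasure lborel (- E \<inter> ball x r)}"
  have "open U1" "open U2"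
    unfolding U1_def U2_def by (intro open_emeasure_Int_ball_gt; measurable)+
  have "U1 \<inter> U2 = {}"
  proof (rule ccontr)
    assume "U1 \<inter> U2 \<noteq> {}"
    then obtain x where "ennreal h < emeasure lborel (E \<inter> ball x r)"
      "ennreal h < emeasure lborel (- E \<inter> ball x r)"
      by (auto simp: U1_def U2_def)
    then have "ennreal h + ennreal h < ennreal (2 * h)"
      unfolding split[of x, symmetric] by (rule add_strict_mono)
    then show False using h by (simp flip: ennreal_plus)
  qed
  moreover have "UNIV \<subseteq> U1 \<union> U2"
  proof
    fix x
    show "x \<in> U1 \<union> U2"
    proof (rule ccontr)
      assume "x \<notin> U1 \<union> U2"
      then have le: "emeasure lborel (E \<inter> ball x r) \<le> ennreal h" "emeasure lborel (- E \<inter> ball x r) \<le> ennreal h"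
        by (auto simp: U1_def U2_def)
      have two: "ennreal (2 * h) = ennreal h + ennreal h"
        using h by (simp flip: ennreal_plus)
      have ge: "ennreal h \<le> emeasure lborel (E \<inter> ball x r)" "ennreal h \<le> emeasure lborel (- E \<inter> ball x r)"
        using split[of x] add_mono[OF le(1) order_refl, of "emeasure lborel (- E \<inter> ball x r)"]
          add_mono[OF order_refl le(2), of "emeasure lborel (E \<inter> ball x r)"]
        unfolding two by (auto simp: add.commute)
      have "ennreal (1 / (2 * r) powr (d + \<alpha>)) * ennreal h * emeasure lborel (E \<inter> ball x r) \<le> ennreal p"
        unfolding p(1)[symmetric] d_def
      proof (rule riesz_energy_ge[OF \<alpha>(1)])
        fix y assume "y \<in> E \<inter> ball x r"
        then have "ball x r \<subseteq> ball y (2 * r)"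
        proof safe
          fix w assume "y \<in> ball x r" "w \<in> ball x r"
          then show "w \<in> ball y (2 * r)"
            using dist_triangle[of y w x] by (simp add: dist_commute)
        qed
        then have "emeasure lborel (- E \<inter> ball x r) \<le> emeasure lborel (ball y (2 * r) - E)"
          by (intro emeasure_mono) auto
        then show "ennreal h \<le> emeasure lborel (ball y (2 * r) - E)" using ge by simp
      qed auto
      then have "ennreal (1 / (2 * r) powr (d + \<alpha>)) * ennreal h * ennreal h \<le> ennreal p"
        using ge(1) by (meson mult_left_mono order_trans zero_le)
      then have "1 / (2 * r) powr (d + \<alpha>) * h * h \<le> p"
        using h p by (simp flip: ennreal_mult)
      then have "h * h \<le> p * (2 * r) powr (d + \<alpha>)"
        using r by (simp add: field_simps)
      then have "(\<omega> * r powr d) * (\<omega> * r powr d) \<le> 4 * (p * (2 * r) powr (d + \<alpha>))"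
        by (simp add: h_def)
      also have "(2 * r) powr (d + \<alpha>) = 2 powr (d + \<alpha>) * r powr (d + \<alpha>)"
        using r by (simp add: powr_mult)
      finally have "(\<omega>\<^sup>2 * r powr (d - \<alpha>)) * r powr (d + \<alpha>) \<le> (4 * p * 2 powr (d + \<alpha>)) * r powr (d + \<alpha>)"
        by (simp add: power2_eq_square mult_ac flip: powr_add)
      then have "\<omega>\<^sup>2 * q \<le> 4 * p * 2 powr (d + \<alpha>)"
        using r unfolding rq by simp
      then show False using \<omega> by (simp add: q_def field_simps)
    qed
  qed
  ultimately have "U1 = {} \<or> U2 = {}"
    using connectedD[OF connected_UNIV \<open>open U1\<close> \<open>open U2\<close>] by auto
  have b: "ennreal h > 0" using h by simp
  from \<open>U1 = {} \<or> U2 = {}\<close> show ?thesis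
  proof
    assume "U1 = {}"
    then have "x \<in> U2" for x using \<open>UNIV \<subseteq> U1 \<union> U2\<close> by auto
    then have "ennreal h \<le> emeasure lborel (ball x r - E)" for x
      by (simp add: U2_def Diff_eq Int_commute less_imp_le)
    then have "emeasure lborel E < \<infinity>"
      by (intro finite_measure_if_complement_thick[OF \<alpha>(1) _ fin r b]) auto
    then show ?thesis ..
  next
    assume "U2 = {}"
    then have "x \<in> U1" for x using \<open>UNIV \<subseteq> U1 \<union> U2\<close> by auto
    then have "ennreal h \<le> emeasure lborel (ball x r - (- E))" for x
      by (simp add: U1_def Diff_eq Int_commute less_imp_le)
    then have "emeasure lborel (- E) < \<infinity>"
      using fin by (intro finite_measure_if_complement_thick[OF \<alpha>(1) _ _ r b]) (auto simp: energy_Compl)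
    then show ?thesis ..
  qed
qed

section \<open>Borel representatives\<close>

lemma lebesgue_set_borel_version:
  assumes "A \<in> sets lebesgue"
  obtains B where "B \<in> sets borel" "AE x in lborel. x \<in> A \<longleftrightarrow> x \<in> B"
    "emeasure lborel B = emeasure lebesgue A"
proof -
  obtain S N N' where A: "A = S \<union> N" and N: "N \<subseteq> N'" "N' \<in> null_sets lborel" "S \<in> sets lborel"
    using assms by (rule sets_completionE)
  have ae: "AE x in lborel. x \<in> A \<longleftrightarrow> x \<in> S"
    using AE_not_in[OF N(2)] by eventually_elim (use A N in auto)
  then have "AE x in lebesgue. x \<in> A \<longleftrightarrow> x \<in> S" by (simp add: AE_completion_iff)
  then have "emeasure lebesgue A = emeasure lebesgue S"
    using assms N(3) by (intro emeasure_eq_AE) auto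
  with ae N(3) that show thesis by simp
qed

lemma nonlocal_perimeter_eq_energy:
  assumes "k \<in> borel_measurable borel" "B \<in> sets borel"
    and k: "AE z in lborel. k z = ennreal (1 / norm z) * \<rho> z"
    and B: "AE x in lborel. x \<in> A \<longleftrightarrow> x \<in> B"
  shows "nonlocal_perimeter \<rho> A = energy k (indicat_real B)"
proof -
  have "ennreal (\<bar>indicat_real A x - indicat_real A y\<bar> / norm (x - y)) * \<rho> (x - y)
      = ennreal \<bar>indicat_real A x - indicat_real A y\<bar> * (ennreal (1 / norm (x - y)) * \<rho> (x - y))" for x y
    by (simp add: divide_inverse ennreal_mult mult.assoc)
  then have "nonlocal_perimeter \<rho> A = (\<integral>\<^sup>+ x. (\<integral>\<^sup>+ y. ennreal \<bar>indicat_real A x - indicat_real A y\<bar> *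
      (ennreal (1 / norm (x - y)) * \<rho> (x - y)) \<partial>lebesgue) \<partial>lebesgue)"
    by (simp add: nonlocal_perimeter_def)
  also have "\<dots> = energy k (indicat_real B)"
  proof (rule double_integral_eq_energy)
    show "AE z in lborel. ennreal (1 / norm z) * \<rho> z = k z"
      using k by eventually_elim simp
    show "AE x in lborel. indicat_real A x = indicat_real B x"
      using B by eventually_elim (simp add: indicator_def)
  qed (use assms in simp_all)
  finally show ?thesis .
qed

lemma fractional_perimeter_eq_energy:
  assumes "B \<in> sets borel" and B: "AE x in lborel. x \<in> A \<longleftrightarrow> x \<in> B"
  shows "fractional_perimeter \<alpha> A = energy (riesz_kernel \<alpha>) (indicat_real B)"
proof -
  have "ennreal (\<bar>indicat_real A x - indicat_real A y\<bar> / norm (x - y) powr (real DIM('a) + \<alpha>))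
      = ennreal \<bar>indicat_real A x - indicat_real A y\<bar> * riesz_kernel \<alpha> (x - y)" for x y
    by (simp add: divide_inverse ennreal_mult riesz_kernel_def)
  then have "fractional_perimeter \<alpha> A = (\<integral>\<^sup>+ x. (\<integral>\<^sup>+ y. ennreal \<bar>indicat_real A x - indicat_real A y\<bar> *
      riesz_kernel \<alpha> (x - y) \<partial>lebesgue) \<partial>lebesgue)"
    by (simp add: fractional_perimeter_def)
  also have "\<dots> = energy (riesz_kernel \<alpha>) (indicat_real B)"
  proof (rule double_integral_eq_energy)
    show "AE x in lborel. indicat_real A x = indicat_real B x"
      using B by eventually_elim (simp add: indicator_def)
  qed (use assms in simp_all)
  finally show ?thesis .
qed

lemma nonlocal_kernel_borel_version:
  fixes \<rho> :: "'a::euclidean_space \<Rightarrow> ennreal"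
  assumes "\<rho> \<in> borel_measurable lebesgue"
  obtains k where "k \<in> borel_measurable borel" "AE z in lborel. k z = ennreal (1 / norm z) * \<rho> z"
proof -
  have "(\<lambda>z. ennreal (1 / norm z)) \<in> borel_measurable lebesgue"
    by (rule measurable_completion) simp
  then have "(\<lambda>z. ennreal (1 / norm z) * \<rho> z) \<in> borel_measurable lebesgue"
    using assms by measurable
  from completion_ex_borel_measurable[OF this]
  obtain k where k: "k \<in> borel_measurable lborel" "AE z in lborel. ennreal (1 / norm z) * \<rho> z = k z" by auto
  have "AE z in lborel. k z = ennreal (1 / norm z) * \<rho> z"
    using k(2) by eventually_elim simp
  then show thesis using that[of k] k(1) by simp
qed

lemma emeasure_symmetric_difference:
  assumes E: "A \<in> sets lebesgue" "E \<in> sets lebesgue"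
    and B: "B \<in> sets borel" "F \<in> sets borel"
    and ae: "AE x in lborel. x \<in> A \<longleftrightarrow> x \<in> B" "AE x in lborel. x \<in> E \<longleftrightarrow> x \<in> F"
  shows "emeasure lebesgue ((A - E) \<union> (E - A))
    = (\<integral>\<^sup>+ x. ennreal \<bar>indicat_real B x - indicat_real F x\<bar> \<partial>lborel)"
proof -
  have "emeasure lebesgue ((A - E) \<union> (E - A)) = (\<integral>\<^sup>+ x. indicator ((A - E) \<union> (E - A)) x \<partial>lebesgue)"
    using E by (intro nn_integral_indicator[symmetric]) auto
  also have "\<dots> = (\<integral>\<^sup>+ x. indicator ((A - E) \<union> (E - A)) x \<partial>lborel)"
    by (rule nn_integral_completion)
  also have "\<dots> = (\<integral>\<^sup>+ x. ennreal \<bar>indicat_real B x - indicat_real F x\<bar> \<partial>lborel)"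
  proof (rule nn_integral_cong_AE)
    show "AE x in lborel. indicator ((A - E) \<union> (E - A)) x = ennreal \<bar>indicat_real B x - indicat_real F x\<bar>"
      using ae by eventually_elim (auto simp: indicator_def)
  qed
  finally show ?thesis .
qed

section \<open>Overlaps of translates\<close>

text \<open>
  This is \<open>|A \<inter> (B + z)|\<close>, the convolution of the indicator of \<open>A\<close> with that of \<open>- B\<close>.
\<close>

definition overlap :: "'a::euclidean_space set \<Rightarrow> 'a set \<Rightarrow> 'a \<Rightarrow> ennreal" where
  "overlap A B z = emeasure lborel {x \<in> A. x - z \<in> B}"

lemma overlap_eq:
  assumes [measurable]: "A \<in> sets borel" "B \<in> sets borel"
  shows "overlap A B z = (\<integral>\<^sup>+ x. indicator A x * indicator B (x - z) \<partial>lborel)"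
proof -
  have "(\<integral>\<^sup>+ x. indicator A x * indicator B (x - z) \<partial>lborel) = (\<integral>\<^sup>+ x. indicator {x \<in> A. x - z \<in> B} x \<partial>lborel)"
    by (intro nn_integral_cong) (auto simp: indicator_def)
  also have "\<dots> = overlap A B z"
    unfolding overlap_def by (rule nn_integral_indicator) measurable
  finally show ?thesis by simp
qed

lemma measurable_overlap [measurable]:
  assumes [measurable]: "A \<in> sets borel" "B \<in> sets borel"
  shows "overlap A B \<in> borel_measurable borel"
proof -
  have "overlap A B = (\<lambda>z. \<integral>\<^sup>+ x. indicator A x * indicator B (x - z) \<partial>lborel)"
    by (intro ext overlap_eq assms)
  then show ?thesis by simp
qed

lemma nn_integral_overlap:
  assumes [measurable]: "A \<in> sets borel" "B \<in> sets borel"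
  shows "(\<integral>\<^sup>+ z. overlap A B z \<partial>lborel) = emeasure lborel A * emeasure lborel B"
proof -
  have "(\<integral>\<^sup>+ z. overlap A B z \<partial>lborel)
      = (\<integral>\<^sup>+ z. (\<integral>\<^sup>+ x. indicator A x * indicator B (x - z) \<partial>lborel) \<partial>lborel)"
    by (simp add: overlap_eq)
  also have "\<dots> = (\<integral>\<^sup>+ x. (\<integral>\<^sup>+ z. indicator A x * indicator B (x - z) \<partial>lborel) \<partial>lborel)"
    by (rule lborel_pair.Fubini') measurable
  also have "\<dots> = (\<integral>\<^sup>+ x. indicator A x * emeasure lborel B \<partial>lborel)"
    using nn_integral_lborel_reflect[of "indicator B"]
    by (simp add: nn_integral_cmult)
  finally show ?thesis by (simp add: nn_integral_multc)
qed

text \<open>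
  The Steinhaus theorem. A compact \<open>T \<subseteq> D\<close> of positive measure has an open neighbourhood of less
  than twice its measure. For small \<open>w\<close> this neighbourhood contains both \<open>T\<close> and \<open>T + w\<close>, so these
  cannot be disjoint up to a null set.
\<close>

lemma self_overlap_near_0:
  fixes D :: "'a::euclidean_space set"
  assumes D [measurable]: "D \<in> sets borel" and "bounded D" "emeasure lborel D > 0"
  obtains e where "e > 0" "\<And>w. norm w < e \<Longrightarrow> emeasure lborel {x \<in> D. x - w \<in> D} > 0"
proof -
  have "emeasure lborel D < \<infinity>" using \<open>bounded D\<close> by (rule emeasure_bounded_finite)
  then obtain m where m: "emeasure lborel D = ennreal m" "m > 0"
    using \<open>emeasure lborel D > 0\<close> by (cases "emeasure lborel D") auto
  obtain T where T: "closed T" "T \<subseteq> D" "D - T \<in> lmeasurable" "emeasure lebesgue (D - T) < ennreal m"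
    by (rule sets_lebesgue_inner_closed[of D m]) (use m(2) D in simp_all)
  have [measurable]: "T \<in> sets borel" using T by auto
  have "compact T" using T \<open>bounded D\<close> bounded_subset by (auto simp: compact_eq_bounded_closed)
  have "emeasure lborel D = emeasure lborel T + emeasure lborel (D - T)"
    using T by (subst plus_emeasure) (auto intro: arg_cong[where f = "emeasure lborel"])
  then have "emeasure lborel T > 0"
    using T(4) m by (auto simp: zero_less_iff_neq_zero)
  moreover have "emeasure lborel T < \<infinity>"
    using \<open>compact T\<close> by (intro emeasure_bounded_finite compact_imp_bounded)
  ultimately obtain t where t: "emeasure lborel T = ennreal t" "t > 0"
    by (cases "emeasure lborel T") auto
  obtain U where U: "open U" "T \<subseteq> U" "emeasure lborel (U - T) < ennreal t"
    using outer_regular_lborel[of T t] t by auto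
  have [measurable]: "U \<in> sets borel" using U by auto
  obtain e where e: "e > 0" "(\<Union>x\<in>T. ball x e) \<subseteq> U"
    using compact_subset_open_imp_ball_epsilon_subset[OF \<open>compact T\<close> \<open>open U\<close> \<open>T \<subseteq> U\<close>] by auto
  show thesis
  proof
    show "e > 0" by fact
    fix w :: 'a assume w: "norm w < e"
    define S where "S = {x. x - w \<in> T}"
    have [measurable]: "S \<in> sets borel" unfolding S_def by measurable
    have S: "emeasure lborel S = ennreal t"
    proof -
      have "emeasure lborel S = (\<integral>\<^sup>+ x. indicator S x \<partial>lborel)" by simp
      also have "\<dots> = (\<integral>\<^sup>+ x. indicator T (x - w) \<partial>lborel)"
        by (intro nn_integral_cong) (auto simp: S_def indicator_def)
      finally show ?thesis using nn_integral_lborel_translate[of "indicator T" w] t by simp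
    qed
    have "S \<subseteq> U"
    proof
      fix x assume "x \<in> S"
      then have "x - w \<in> T" "x \<in> ball (x - w) e" using w by (auto simp: S_def dist_norm)
      then show "x \<in> U" using e(2) by blast
    qed
    have "emeasure lborel (T \<inter> S) > 0"
    proof (rule ccontr)
      assume "\<not> emeasure lborel (T \<inter> S) > 0"
      then have "emeasure lborel S = emeasure lborel (S - T \<inter> S)"
        by (intro emeasure_Diff_null_set[symmetric]) (auto simp: null_sets_def)
      also have "\<dots> \<le> emeasure lborel (U - T)"
        using \<open>S \<subseteq> U\<close> by (intro emeasure_mono) auto
      finally show False using U(3) S by simp
    qed
    also have "emeasure lborel (T \<inter> S) \<le> emeasure lborel {x \<in> D. x - w \<in> D}"
      using T(2) by (intro emeasure_mono) (auto simp: S_def)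
    finally show "emeasure lborel {x \<in> D. x - w \<in> D} > 0" .
  qed
qed

text \<open>
  The overlap has positive integral, hence is positive at some shift \<open>z0\<close>; applying
  \<open>self_overlap_near_0\<close> to the part of \<open>A\<close> that overlaps there shows that it remains positive nearby.
\<close>

lemma overlap_pos_on_open:
  fixes A B :: "'a::euclidean_space set"
  assumes [measurable]: "A \<in> sets borel" "B \<in> sets borel"
    and pos: "emeasure lborel A > 0" "emeasure lborel B > 0"
    and sub: "A \<subseteq> ball x r" "B \<subseteq> ball x r"
  obtains U where "open U" "U \<noteq> {}" "U \<subseteq> ball 0 (2 * r)" "\<And>z. z \<in> U \<Longrightarrow> overlap A B z > 0"
proof -
  obtain z0 where z0: "overlap A B z0 > 0"
  proof (rule ccontr)
    assume "\<not> thesis"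
    with that have "overlap A B z = 0" for z using zero_less_iff_neq_zero by blast
    then have "emeasure lborel A * emeasure lborel B = 0"
      using nn_integral_overlap[of A B] by simp
    with pos show False by auto
  qed
  define D where "D = {x \<in> A. x - z0 \<in> B}"
  have [measurable]: "D \<in> sets borel" unfolding D_def by measurable
  have "D \<subseteq> ball x r" using sub(1) by (auto simp: D_def)
  then have "bounded D" by (rule bounded_subset[OF bounded_ball])
  obtain e where e: "e > 0" "\<And>w. norm w < e \<Longrightarrow> emeasure lborel {x \<in> D. x - w \<in> D} > 0"
    using self_overlap_near_0[of D] z0 \<open>bounded D\<close> unfolding overlap_def D_def[symmetric] by auto
  have pos': "overlap A B z > 0" if "z \<in> ball z0 e" for z
  proof -
    have "norm (z - z0) < e" using that by (simp add: dist_norm norm_minus_commute)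
    then have "0 < emeasure lborel {x \<in> D. x - (z - z0) \<in> D}" by (rule e)
    also have "\<dots> \<le> overlap A B z"
      unfolding overlap_def
      by (intro emeasure_mono) (auto simp: D_def)
    finally show ?thesis .
  qed
  have "ball z0 e \<subseteq> ball 0 (2 * r)"
  proof
    fix z assume "z \<in> ball z0 e"
    then have "overlap A B z > 0" by (rule pos')
    then have "{x \<in> A. x - z \<in> B} \<noteq> {}" by (metis emeasure_empty less_irrefl overlap_def)
    then obtain y where "y \<in> ball x r" "y - z \<in> ball x r" using sub by blast
    then show "z \<in> ball 0 (2 * r)"
      using dist_triangle[of y "y - z" x] by (simp add: dist_commute dist_norm)
  qed
  then show thesis using that[of "ball z0 e"] e(1) pos' by auto
qed

section \<open>Indecomposable sets\<close>

text \<open>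
  Pairs with one point in \<open>A\<close> and the other in \<open>B\<close> are counted on the right but not for the union;
  so a decomposition must have zero interaction between its parts.
\<close>

lemma energy_disjoint_Un_le:
  fixes A B :: "'a::euclidean_space set"
  assumes [measurable]: "A \<in> sets borel" "B \<in> sets borel" "k \<in> borel_measurable borel"
    and "A \<inter> B = {}"
  shows "energy k (indicat_real (A \<union> B)) + (\<integral>\<^sup>+ z. k z * overlap A B z \<partial>lborel)
    \<le> energy k (indicat_real A) + energy k (indicat_real B)"
proof -
  have "increment (indicat_real (A \<union> B)) z + overlap A B z
      \<le> increment (indicat_real A) z + increment (indicat_real B) z" for z
  proof -
    have "ennreal \<bar>indicat_real (A \<union> B) x - indicat_real (A \<union> B) (x - z)\<bar> + indicator A x * indicator B (x - z)
       \<le> ennreal \<bar>indicat_real A x - indicat_real A (x - z)\<bar> + ennreal \<bar>indicat_real B x - indicat_real B (x - z)\<bar>"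
      for x
      using \<open>A \<inter> B = {}\<close> by (auto simp: indicator_def)
    then show ?thesis
      unfolding increment_def
      by (simp add: overlap_eq flip: nn_integral_add) (intro nn_integral_mono)
  qed
  then have "(\<integral>\<^sup>+ z. k z * (increment (indicat_real (A \<union> B)) z + overlap A B z) \<partial>lborel)
      \<le> (\<integral>\<^sup>+ z. k z * (increment (indicat_real A) z + increment (indicat_real B) z) \<partial>lborel)"
    by (intro nn_integral_mono mult_left_mono) auto
  then show ?thesis
    by (simp add: energy_def distrib_left nn_integral_add)
qed

text \<open>
  Countably many balls of radius \<open>r\<close> cover the space.
\<close>

lemma ex_ball_positive_measure:
  fixes F :: "'a::euclidean_space set"
  assumes [measurable]: "F \<in> sets borel" and pos: "0 < emeasure lborel F" and "r > 0"
  shows "\<exists>x. 0 < emeasure lborel (F \<inter> ball x r)"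
proof (rule ccontr)
  assume empty: "\<not> ?thesis"
  obtain X where X: "countable X" "closure X = (UNIV :: 'a set)"
    using separable[of "UNIV :: 'a set"] by (metis closure_subset top.extremum_uniqueI)
  have cover: "F \<subseteq> (\<Union>x\<in>X. F \<inter> ball x r)"
  proof
    fix y assume "y \<in> F"
    have "y \<in> closure X" using X by simp
    then obtain x where "x \<in> X" "dist x y < r"
      using \<open>r > 0\<close> unfolding closure_approachable by meson
    then show "y \<in> (\<Union>x\<in>X. F \<inter> ball x r)" using \<open>y \<in> F\<close> by auto
  qed
  have "(\<Union>x\<in>X. F \<inter> ball x r) \<in> null_sets lborel"
    using empty X(1) by (intro null_sets_UN') (auto simp: null_sets_def zero_less_iff_neq_zero)
  then have "F \<in> null_sets lborel"
    by (rule null_sets_subset) (use cover in auto)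
  with pos show False by auto
qed

text \<open>
  Otherwise the centres of the balls that meet \<open>F1\<close> and those of the balls that meet \<open>F2\<close>, both in
  positive measure, would split the space into two disjoint nonempty open sets.
\<close>

lemma meet_in_common_ball:
  fixes F1 F2 :: "'a::euclidean_space set"
  assumes [measurable]: "F1 \<in> sets borel" "F2 \<in> sets borel"
    and pos: "0 < emeasure lborel F1" "0 < emeasure lborel F2" and "r > 0"
    and dense: "\<And>x. 0 < emeasure lborel ((F1 \<union> F2) \<inter> ball x r)"
  obtains x where "0 < emeasure lborel (F1 \<inter> ball x r)" "0 < emeasure lborel (F2 \<inter> ball x r)"
proof (rule ccontr)
  assume no: "\<not> thesis"
  define U where "U F = {x. 0 < emeasure lborel (F \<inter> ball x r)}" for F :: "'a set"
  have "open (U F1)" "open (U F2)"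
    unfolding U_def by (intro open_emeasure_Int_ball_gt; measurable)+
  moreover have "U F1 \<inter> U F2 = {}"
    using no that by (auto simp: U_def)
  moreover have "UNIV \<subseteq> U F1 \<union> U F2"
  proof
    fix x
    have "0 < emeasure lborel ((F1 \<union> F2) \<inter> ball x r)" by (rule dense)
    also have "(F1 \<union> F2) \<inter> ball x r = F1 \<inter> ball x r \<union> F2 \<inter> ball x r" by blast
    also have "emeasure lborel \<dots> \<le> emeasure lborel (F1 \<inter> ball x r) + emeasure lborel (F2 \<inter> ball x r)"
      by (intro emeasure_subadditive) auto
    finally show "x \<in> U F1 \<union> U F2" by (auto simp: U_def zero_less_iff_neq_zero)
  qed
  ultimately have "U F1 = {} \<or> U F2 = {}"
    using connectedD[OF connected_UNIV, of "U F1" "U F2"] by auto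
  then show False
    using ex_ball_positive_measure[of F1 r] ex_ball_positive_measure[of F2 r] pos \<open>r > 0\<close>
    by (auto simp: U_def)
qed

text \<open>
  The kernel may vanish on large sets, but on no nonempty open subset of \<open>ball 0 \<epsilon>\<close> does it vanish
  almost everywhere. The overlap, restricted to the common ball, is positive on such a subset.
\<close>

lemma overlap_integral_pos:
  fixes F1 F2 :: "'a::euclidean_space set" and \<rho> :: "'a \<Rightarrow> ennreal"
  assumes [measurable]: "F1 \<in> sets borel" "F2 \<in> sets borel" "k \<in> borel_measurable borel"
    and k: "AE z in lborel. k z = ennreal (1 / norm z) * \<rho> z"
    and supp: "essential_support \<rho> = cball 0 \<epsilon>"
    and x: "emeasure lborel (F1 \<inter> ball x (\<epsilon> / 2)) > 0" "emeasure lborel (F2 \<inter> ball x (\<epsilon> / 2)) > 0"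
  shows "(\<integral>\<^sup>+ z. k z * overlap F1 F2 z \<partial>lborel) > 0"
proof (rule ccontr)
  assume "\<not> ?thesis"
  then have "(\<integral>\<^sup>+ z. k z * overlap F1 F2 z \<partial>lborel) = 0" by simp
  then have zero: "AE z in lborel. k z * overlap F1 F2 z = 0"
    by (subst (asm) nn_integral_0_iff_AE) auto
  obtain V where V: "open V" "V \<noteq> {}" "V \<subseteq> ball 0 \<epsilon>"
    "\<And>z. z \<in> V \<Longrightarrow> overlap (F1 \<inter> ball x (\<epsilon> / 2)) (F2 \<inter> ball x (\<epsilon> / 2)) z > 0"
    using overlap_pos_on_open[OF _ _ x, of x "\<epsilon> / 2"] by auto
  have overlap_pos: "overlap F1 F2 z > 0" if "z \<in> V" for z
  proof -
    have "overlap (F1 \<inter> ball x (\<epsilon> / 2)) (F2 \<inter> ball x (\<epsilon> / 2)) z \<le> overlap F1 F2 z"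
      unfolding overlap_def by (intro emeasure_mono) auto
    then show ?thesis using V(4)[OF that] by simp
  qed
  have "AE z in lborel. z \<noteq> (0 :: 'a)" by (rule AE_lborel_singleton)
  with zero k have "AE z in lborel. z \<in> V \<longrightarrow> \<rho> z = 0"
    by eventually_elim (use overlap_pos in force)
  then have "V \<subseteq> - essential_support \<rho>"
    using V(1) by (auto simp: essential_support_def AE_completion_iff)
  then show False using V supp by force
qed

text \<open>
  The two alternatives for \<open>A\<close> serve bounded sets and complements of bounded sets. In either case the
  parts of a decomposition would share positive measure with a common ball of radius \<open>\<epsilon> / 2\<close>, and the
  resulting interaction contradicts the additivity of the perimeter.
\<close>

lemma indecomposableI:
  fixes A :: "'a::euclidean_space set" and \<rho> :: "'a \<Rightarrow> ennreal"
  assumes [measurable]: "A \<in> sets borel" "k \<in> borel_measurable borel"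
    and k: "AE z in lborel. k z = ennreal (1 / norm z) * \<rho> z"
    and supp: "essential_support \<rho> = cball 0 \<epsilon>" and "\<epsilon> > 0"
    and fin: "energy k (indicat_real A) < \<infinity>"
    and A: "A \<subseteq> ball c (\<epsilon> / 2) \<or> (\<forall>x. 0 < emeasure lborel (A \<inter> ball x (\<epsilon> / 2)))"
  shows "indecomposable \<rho> A"
proof (rule ccontr)
  note perimeter = nonlocal_perimeter_eq_energy[OF assms(2) _ k]
  have P: "nonlocal_perimeter \<rho> A = energy k (indicat_real A)"
    by (rule perimeter) auto
  assume "\<not> indecomposable \<rho> A"
  then have "decomposable \<rho> A"
    using fin P by (simp add: indecomposable_def)
  then obtain E1 E2 where E: "E1 \<in> sets lebesgue" "E2 \<in> sets lebesgue" "E1 \<union> E2 = A" "E1 \<inter> E2 = {}"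
    "emeasure lebesgue E1 > 0" "emeasure lebesgue E2 > 0"
    "nonlocal_perimeter \<rho> A = nonlocal_perimeter \<rho> E1 + nonlocal_perimeter \<rho> E2"
    unfolding decomposable_def by blast
  obtain F1 where F1 [measurable]: "F1 \<in> sets borel" and F1_AE: "AE x in lborel. x \<in> E1 \<longleftrightarrow> x \<in> F1"
    and F1_pos: "emeasure lborel F1 = emeasure lebesgue E1"
    using E(1) by (rule lebesgue_set_borel_version)
  \<comment> \<open>equal to \<open>E2\<close> up to a null set and, unlike an arbitrary representative of it, disjoint from \<open>F1\<close>\<close>
  define F2 where "F2 = A - F1"
  have F2 [measurable]: "F2 \<in> sets borel" unfolding F2_def by measurable
  have F2_AE: "AE x in lborel. x \<in> E2 \<longleftrightarrow> x \<in> F2"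
    using F1_AE by eventually_elim (use E in \<open>auto simp: F2_def\<close>)
  have F2_pos: "emeasure lborel F2 > 0"
  proof -
    have "AE x in lebesgue. x \<in> E2 \<longleftrightarrow> x \<in> F2" using F2_AE by (simp add: AE_completion_iff)
    then have "emeasure lebesgue E2 = emeasure lebesgue F2"
      using E F2 by (intro emeasure_eq_AE) auto
    then show ?thesis using E by simp
  qed
  have Un_AE: "AE x in lborel. x \<in> A \<longleftrightarrow> x \<in> F1 \<union> F2"
    using F1_AE by eventually_elim (use E in \<open>auto simp: F2_def\<close>)
  have "energy k (indicat_real (F1 \<union> F2)) = energy k (indicat_real F1) + energy k (indicat_real F2)"
    using E(7) perimeter[OF _ F1_AE] perimeter[OF _ F2_AE] perimeter[OF _ Un_AE] by simp
  moreover have "energy k (indicat_real (F1 \<union> F2)) < \<infinity>"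
    using perimeter[OF _ Un_AE] P fin by simp
  ultimately have "energy k (indicat_real (F1 \<union> F2)) + (\<integral>\<^sup>+ z. k z * overlap F1 F2 z \<partial>lborel)
      \<le> energy k (indicat_real (F1 \<union> F2)) + 0" "energy k (indicat_real (F1 \<union> F2)) \<noteq> \<infinity>"
    using energy_disjoint_Un_le[of F1 F2 k] by (auto simp: F2_def)
  then have zero: "(\<integral>\<^sup>+ z. k z * overlap F1 F2 z \<partial>lborel) = 0"
    by (simp add: ennreal_add_left_cancel_le)
  obtain x where x: "emeasure lborel (F1 \<inter> ball x (\<epsilon> / 2)) > 0" "emeasure lborel (F2 \<inter> ball x (\<epsilon> / 2)) > 0"
    using A
  proof
    assume sub: "A \<subseteq> ball c (\<epsilon> / 2)"
    have "emeasure lborel (F1 \<inter> ball c (\<epsilon> / 2)) = emeasure lborel F1"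
    proof (rule emeasure_eq_AE)
      show "AE x in lborel. x \<in> F1 \<inter> ball c (\<epsilon> / 2) \<longleftrightarrow> x \<in> F1"
        using F1_AE by eventually_elim (use E sub in auto)
    qed auto
    moreover have "F2 \<inter> ball c (\<epsilon> / 2) = F2" using sub by (auto simp: F2_def)
    ultimately show thesis using that[of c] F1_pos F2_pos E(5) by simp
  next
    assume dense: "\<forall>x. 0 < emeasure lborel (A \<inter> ball x (\<epsilon> / 2))"
    show thesis
    proof (rule meet_in_common_ball[of F1 F2 "\<epsilon> / 2"])
      show "0 < emeasure lborel ((F1 \<union> F2) \<inter> ball x (\<epsilon> / 2))" for x
      proof -
        have "emeasure lborel (A \<inter> ball x (\<epsilon> / 2)) \<le> emeasure lborel ((F1 \<union> F2) \<inter> ball x (\<epsilon> / 2))"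
          by (intro emeasure_mono) (auto simp: F2_def)
        then show ?thesis using dense by (meson less_le_trans)
      qed
    qed (use F1_pos F2_pos E(5) \<open>\<epsilon> > 0\<close> that in auto)
  qed
  show False
    using overlap_integral_pos[OF F1 F2 assms(2) k supp x] zero by simp
qed

section \<open>Upper limits and diagonal sequences\<close>

lemma ennreal_le_add_diff: "a \<le> b + (a - b :: ennreal)"
  using ennreal_minus_le_iff[of a b "a - b"] by simp

lemma limsup_le_if_eventually_close:
  fixes f :: "nat \<Rightarrow> ennreal"
  assumes "\<And>j. \<forall>\<^sub>F n in sequentially. f n \<le> c + ennreal (1 / real (Suc j))"
  shows "limsup f \<le> c"
proof (rule ennreal_le_epsilon)
  fix e :: real assume "0 < e"
  then obtain j where j: "1 / real (Suc j) < e" by (rule nat_approx_posE)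
  have "limsup f \<le> c + ennreal (1 / real (Suc j))"
    by (rule Limsup_bounded[OF assms])
  also have "\<dots> \<le> c + ennreal e" using j by (intro add_left_mono ennreal_leI) simp
  finally show "limsup f \<le> c + ennreal e" .
qed

text \<open>
  At stage \<open>n\<close> the best accuracy \<open>j \<le> n\<close> available there is used. The default \<open>d\<close> covers the stages
  at which none is available.
\<close>

lemma diagonal_selection:
  fixes Q :: "nat \<Rightarrow> nat \<Rightarrow> 'b \<Rightarrow> bool"
  assumes ev: "\<And>j. \<forall>\<^sub>F n in sequentially. \<exists>a. Q j n a"
    and anti: "\<And>i j n a. i \<le> j \<Longrightarrow> Q j n a \<Longrightarrow> Q i n a"
  obtains a where "\<And>j. \<forall>\<^sub>F n in sequentially. Q j n (a n)" "\<And>n. a n = d \<or> (\<exists>j. Q j n (a n))"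
proof -
  define S where "S n = {j. j \<le> n \<and> (\<exists>a. Q j n a)}" for n
  define a where "a n = (if S n = {} then d else SOME x. Q (Max (S n)) n x)" for n
  have fin: "finite (S n)" for n unfolding S_def by simp
  have Q: "Q (Max (S n)) n (a n)" if "S n \<noteq> {}" for n
  proof -
    have "Max (S n) \<in> S n" using fin that by (rule Max_in)
    then have "\<exists>x. Q (Max (S n)) n x" by (simp add: S_def)
    then show ?thesis using that by (simp add: a_def someI_ex)
  qed
  show thesis
  proof
    fix j
    show "\<forall>\<^sub>F n in sequentially. Q j n (a n)"
      using ev[of j] eventually_ge_at_top[of j]
    proof eventually_elim
      case (elim n)
      then have j: "j \<in> S n" by (simp add: S_def)
      then have "j \<le> Max (S n)" using fin by simp
      with j Q[of n] anti show ?case by blast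
    qed
    show "a n = d \<or> (\<exists>j. Q j n (a n))" for n
      using Q[of n] by (cases "S n = {}") (auto simp: a_def)
  qed
qed

section \<open>Energies along converging kernels\<close>

text \<open>
  The weight \<open>min 1 |z|\<close> is chosen because increments of Lipschitz functions with bounded support
  are of that order. In \<^typ>\<open>ennreal\<close>, with its truncated subtraction, the sum of the two differences
  is the absolute value of the difference.
\<close>

locale kernel_convergence =
  fixes k :: "nat \<Rightarrow> 'a::euclidean_space \<Rightarrow> ennreal" and \<kappa> :: "'a \<Rightarrow> ennreal"
  assumes meas_k [measurable]: "\<And>n. k n \<in> borel_measurable borel"
    and meas_\<kappa> [measurable]: "\<kappa> \<in> borel_measurable borel"
    and AE_tendsto: "AE z in lborel. (\<lambda>n. k n z) \<longlonglongrightarrow> \<kappa> z"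
    and limit_integrable: "(\<integral>\<^sup>+ z. ennreal (min 1 (norm z)) * \<kappa> z \<partial>lborel) < \<infinity>"
    and L1_tendsto: "(\<lambda>n. \<integral>\<^sup>+ z. (ennreal (min 1 (norm z)) * k n z - ennreal (min 1 (norm z)) * \<kappa> z)
      + (ennreal (min 1 (norm z)) * \<kappa> z - ennreal (min 1 (norm z)) * k n z) \<partial>lborel) \<longlonglongrightarrow> 0"
begin

definition excess :: "nat \<Rightarrow> ennreal" where
  "excess n = (\<integral>\<^sup>+ z. ennreal (min 1 (norm z)) * (k n z - \<kappa> z) \<partial>lborel)"

lemma excess_tendsto: "excess \<longlonglongrightarrow> 0"
proof (rule tendsto_sandwich[OF _ _ tendsto_const L1_tendsto])
  show "\<forall>\<^sub>F n in sequentially. excess n \<le> (\<integral>\<^sup>+ z. (ennreal (min 1 (norm z)) * k n z - ennreal (min 1 (norm z)) * \<kappa> z)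
      + (ennreal (min 1 (norm z)) * \<kappa> z - ennreal (min 1 (norm z)) * k n z) \<partial>lborel)"
    unfolding excess_def
    by (intro always_eventually allI nn_integral_mono) (simp add: ennreal_right_diff_distrib)
qed auto

text \<open>
  Since \<open>k n \<le> \<kappa> + (k n - \<kappa>)\<close> and \<open>v\<close> pays for the second summand at most \<open>C\<close> times the weight.
\<close>

lemma energy_le_excess:
  assumes [measurable]: "v \<in> borel_measurable borel" and "C \<ge> 0"
    and v: "\<And>z. increment v z \<le> ennreal (C * min 1 (norm z))"
  shows "energy (k n) v \<le> energy \<kappa> v + ennreal C * excess n"
proof -
  have "k n z * increment v z \<le> \<kappa> z * increment v z + ennreal C * (ennreal (min 1 (norm z)) * (k n z - \<kappa> z))" for z
  proof -
    have "k n z * increment v z \<le> (\<kappa> z + (k n z - \<kappa> z)) * increment v z"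
      by (intro mult_right_mono ennreal_le_add_diff) auto
    also have "\<dots> = \<kappa> z * increment v z + (k n z - \<kappa> z) * increment v z"
      by (rule distrib_right)
    also have "\<dots> \<le> \<kappa> z * increment v z + (k n z - \<kappa> z) * ennreal (C * min 1 (norm z))"
      by (intro add_left_mono mult_left_mono v) auto
    also have "ennreal (C * min 1 (norm z)) = ennreal C * ennreal (min 1 (norm z))"
      using \<open>C \<ge> 0\<close> by (intro ennreal_mult) auto
    finally show ?thesis by (simp add: mult_ac)
  qed
  then have "energy (k n) v
     \<le> (\<integral>\<^sup>+ z. \<kappa> z * increment v z + ennreal C * (ennreal (min 1 (norm z)) * (k n z - \<kappa> z)) \<partial>lborel)"
    unfolding energy_def by (intro nn_integral_mono)
  also have "\<dots> = energy \<kappa> v + ennreal C * excess n"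
    unfolding energy_def excess_def by (subst nn_integral_add) (simp_all add: nn_integral_cmult)
  finally show ?thesis .
qed

text \<open>
  Kernels below all \<open>k n\<close> with \<open>n \<ge> j\<close>. Removing a neighbourhood of the origin, where \<open>k j\<close> may
  fail to be integrable, makes them integrable.
\<close>

definition lower_kernel :: "nat \<Rightarrow> 'a \<Rightarrow> ennreal" where
  "lower_kernel j z = (INF m\<in>{j..}. k m z) * indicator {z. 1 / real (Suc j) \<le> norm z} z"

lemma measurable_lower_kernel [measurable]: "lower_kernel j \<in> borel_measurable borel"
  unfolding lower_kernel_def by measurable

lemma incseq_lower_kernel: "i \<le> j \<Longrightarrow> lower_kernel i z \<le> lower_kernel j z"
proof -
  assume "i \<le> j"
  then have "1 / real (Suc j) \<le> 1 / real (Suc i)" by (simp add: frac_le)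
  with \<open>i \<le> j\<close> show ?thesis
    unfolding lower_kernel_def
    by (intro mult_mono INF_superset_mono) (auto simp: indicator_def)
qed

lemma lower_kernel_le: "j \<le> n \<Longrightarrow> lower_kernel j z \<le> k n z"
  by (auto simp: lower_kernel_def indicator_def intro: INF_lower)

text \<open>
  Off the origin, the limit \<open>\<kappa> z\<close> is the supremum of the infima \<open>INF m \<in> {n..}. k m z\<close>.
\<close>

lemma limit_kernel_le_SUP: "AE z in lborel. \<kappa> z \<le> (SUP j. lower_kernel j z)"
  using AE_tendsto AE_lborel_singleton[of 0]
proof eventually_elim
  case (elim z)
  have "\<kappa> z = liminf (\<lambda>n. k n z)"
    using lim_imp_Liminf[OF sequentially_bot elim(1)] by simp
  also have "\<dots> = (SUP n. INF m\<in>{n..}. k m z)" by (rule liminf_SUP_INF)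
  also have "\<dots> \<le> (SUP j. lower_kernel j z)"
  proof (rule SUP_least)
    fix n :: nat
    obtain i where i: "1 / real (Suc i) < norm z"
      using elim(2) nat_approx_posE[of "norm z"] by auto
    have "1 / real (Suc (max n i)) \<le> 1 / real (Suc i)" by (simp add: frac_le)
    then have "(INF m\<in>{n..}. k m z) \<le> lower_kernel (max n i) z"
      using i by (auto simp: lower_kernel_def intro!: INF_superset_mono)
    also have "\<dots> \<le> (SUP j. lower_kernel j z)" by (rule SUP_upper) simp
    finally show "(INF m\<in>{n..}. k m z) \<le> (SUP j. lower_kernel j z)" .
  qed
  finally show ?case .
qed

lemma lower_kernel_integrable:
  assumes "excess j < \<infinity>"
  shows "(\<integral>\<^sup>+ z. lower_kernel j z \<partial>lborel) < \<infinity>"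
proof -
  have "lower_kernel j z \<le> ennreal (real (Suc j)) *
      (ennreal (min 1 (norm z)) * \<kappa> z + ennreal (min 1 (norm z)) * (k j z - \<kappa> z))" for z
  proof (cases "1 / real (Suc j) \<le> norm z")
    case True
    have "lower_kernel j z \<le> 1 * k j z" using lower_kernel_le[of j j z] by simp
    also have "\<dots> \<le> ennreal (real (Suc j) * min 1 (norm z)) * k j z"
    proof (rule mult_right_mono)
      have "1 \<le> real (Suc j) * min 1 (norm z)"
        using True by (auto simp: min_def field_simps)
      then show "1 \<le> ennreal (real (Suc j) * min 1 (norm z))"
        by (simp add: ennreal_ge_1)
    qed simp
    also have "\<dots> \<le> ennreal (real (Suc j) * min 1 (norm z)) * (\<kappa> z + (k j z - \<kappa> z))"
      by (intro mult_left_mono ennreal_le_add_diff) simp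
    also have "\<dots> = ennreal (real (Suc j)) *
      (ennreal (min 1 (norm z)) * \<kappa> z + ennreal (min 1 (norm z)) * (k j z - \<kappa> z))"
      by (subst ennreal_mult) (auto simp: distrib_left mult.assoc)
    finally show ?thesis .
  qed (simp add: lower_kernel_def)
  then have "(\<integral>\<^sup>+ z. lower_kernel j z \<partial>lborel) \<le> (\<integral>\<^sup>+ z. ennreal (real (Suc j)) *
      (ennreal (min 1 (norm z)) * \<kappa> z + ennreal (min 1 (norm z)) * (k j z - \<kappa> z)) \<partial>lborel)"
    by (intro nn_integral_mono)
  also have "\<dots> = ennreal (real (Suc j)) * ((\<integral>\<^sup>+ z. ennreal (min 1 (norm z)) * \<kappa> z \<partial>lborel) + excess j)"
    unfolding excess_def by (subst nn_integral_cmult) (simp_all add: nn_integral_add)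
  also have "\<dots> < \<infinity>"
    using assms limit_integrable by (auto simp: ennreal_mult_less_top)
  finally show ?thesis .
qed

text \<open>
  For fixed \<open>j\<close> the integrable kernel \<open>lower_kernel j\<close> gives an energy that is continuous in \<open>L\<^sup>1\<close>
  and lies below that of \<open>k n\<close> for \<open>n \<ge> j\<close>. The supremum over \<open>j\<close> follows by monotone convergence;
  unlike a pointwise limit it commutes with the factor \<open>increment u z\<close> even where that is infinite.
\<close>

lemma energy_le_liminf:
  assumes [measurable]: "u \<in> borel_measurable borel" "\<And>n. un n \<in> borel_measurable borel"
    and conv: "(\<lambda>n. \<integral>\<^sup>+ x. ennreal \<bar>un n x - u x\<bar> \<partial>lborel) \<longlonglongrightarrow> 0"
  shows "energy \<kappa> u \<le> liminf (\<lambda>n. energy (k n) (un n))"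
proof -
  let ?L = "liminf (\<lambda>n. energy (k n) (un n))"
  define D where "D n = (\<integral>\<^sup>+ x. ennreal \<bar>un n x - u x\<bar> \<partial>lborel)" for n
  have lower: "energy (lower_kernel j) u \<le> ?L" if j: "excess j < \<infinity>" for j
  proof -
    define I where "I = (\<integral>\<^sup>+ z. lower_kernel j z \<partial>lborel)"
    have I: "I < \<infinity>" unfolding I_def using j by (rule lower_kernel_integrable)
    have bound: "energy (lower_kernel j) u - I * (2 * D n) \<le> energy (k n) (un n)"
      if "j \<le> n" "D n < 1" for n
    proof -
      have "I * (2 * D n) < \<infinity>"
        using I \<open>D n < 1\<close> by (auto simp: ennreal_mult_less_top intro: less_trans)
      have "increment u z \<le> increment (un n) z + 2 * D n" for z
        using increment_le[of u "un n" z] by (simp add: D_def abs_minus_commute)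
      then have "energy (lower_kernel j) u
          \<le> (\<integral>\<^sup>+ z. lower_kernel j z * increment (un n) z + lower_kernel j z * (2 * D n) \<partial>lborel)"
        unfolding energy_def by (intro nn_integral_mono) (metis distrib_left mult_left_mono zero_le)
      also have "\<dots> = energy (lower_kernel j) (un n) + I * (2 * D n)"
        unfolding energy_def I_def by (subst nn_integral_add) (simp_all add: nn_integral_multc)
      also have "energy (lower_kernel j) (un n) \<le> energy (k n) (un n)"
        by (intro energy_mono_kernel lower_kernel_le \<open>j \<le> n\<close>)
      finally have "energy (lower_kernel j) u \<le> I * (2 * D n) + energy (k n) (un n)"
        by (simp add: add.commute add_left_mono)
      then show ?thesis
        using \<open>I * (2 * D n) < \<infinity>\<close> by (auto simp: ennreal_minus_le_iff)
    qed
    have "\<forall>\<^sub>F n in sequentially. D n < 1"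
      unfolding D_def by (rule order_tendstoD(2)[OF conv]) simp
    then have "\<forall>\<^sub>F n in sequentially. energy (lower_kernel j) u - I * (2 * D n) \<le> energy (k n) (un n)"
      using eventually_ge_at_top[of j] by eventually_elim (rule bound)
    then have "liminf (\<lambda>n. energy (lower_kernel j) u - I * (2 * D n)) \<le> ?L"
      by (rule Liminf_mono)
    moreover have "(\<lambda>n. energy (lower_kernel j) u - I * (2 * D n)) \<longlonglongrightarrow> energy (lower_kernel j) u - I * (2 * 0)"
      using conv I unfolding D_def[symmetric]
      by (intro tendsto_diff_ennreal_general tendsto_const ennreal_tendsto_cmult) auto
    then have "liminf (\<lambda>n. energy (lower_kernel j) u - I * (2 * D n)) = energy (lower_kernel j) u"
      using lim_imp_Liminf[OF sequentially_bot] by fastforce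
    ultimately show ?thesis by simp
  qed
  have "\<forall>\<^sub>F j in sequentially. excess j < 1"
    by (rule order_tendstoD(2)[OF excess_tendsto]) simp
  then obtain N where N: "\<And>j. j \<ge> N \<Longrightarrow> excess j < 1"
    by (auto simp: eventually_at_top_linorder)
  have all: "energy (lower_kernel j) u \<le> ?L" for j
  proof -
    have "energy (lower_kernel j) u \<le> energy (lower_kernel (max j N)) u"
      by (intro energy_mono_kernel incseq_lower_kernel) simp
    also have "\<dots> \<le> ?L" using N[of "max j N"] by (intro lower) (auto intro: less_trans)
    finally show ?thesis .
  qed
  have "energy \<kappa> u \<le> (\<integral>\<^sup>+ z. (SUP j. lower_kernel j z) * increment u z \<partial>lborel)"
    unfolding energy_def
    by (rule nn_integral_mono_AE) (use limit_kernel_le_SUP in \<open>auto elim!: eventually_mono intro: mult_right_mono\<close>)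
  also have "\<dots> = (\<integral>\<^sup>+ z. (SUP j. lower_kernel j z * increment u z) \<partial>lborel)"
    by (simp add: SUP_mult_right_ennreal)
  also have "\<dots> = (SUP j. energy (lower_kernel j) u)"
    unfolding energy_def
    by (rule nn_integral_monotone_convergence_SUP)
      (auto simp: incseq_def le_fun_def intro!: mult_right_mono incseq_lower_kernel)
  also have "\<dots> \<le> ?L" using all by (rule SUP_least)
  finally show ?thesis .
qed

end

section \<open>Recovery sequences\<close>

text \<open>
  The superlevel set \<open>A\<close> may change with \<open>n\<close>, while its bound \<open>R\<close> may not: the radius must be
  eventually small compared with \<open>\<epsilon> n\<close>. Levels between \<open>\<theta>\<close> and \<open>1 - \<theta>\<close> keep \<open>A\<close> close to \<open>E\<close>,
  because \<open>v\<close> differs from the indicator of \<open>E\<close> by at least \<open>\<theta>\<close> wherever \<open>A\<close> and \<open>E\<close> disagree.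
\<close>

lemma recovery_finite_measure:
  fixes k :: "nat \<Rightarrow> 'a::euclidean_space \<Rightarrow> ennreal"
  assumes conv: "kernel_convergence k (riesz_kernel \<alpha>)" and \<alpha>: "\<alpha> > 0"
    and [measurable]: "E \<in> sets borel"
    and E: "emeasure lborel E < \<infinity>" "energy (riesz_kernel \<alpha>) (indicat_real E) < \<infinity>"
    and e: "e > 0"
  obtains R where "\<forall>\<^sub>F n in sequentially. \<exists>A \<in> sets borel. A \<subseteq> ball 0 R \<and>
    (\<integral>\<^sup>+ x. ennreal \<bar>indicat_real A x - indicat_real E x\<bar> \<partial>lborel) \<le> ennreal e \<and>
    energy (k n) (indicat_real A) \<le> energy (riesz_kernel \<alpha>) (indicat_real E) + ennreal e"
proof -
  interpret kernel_convergence k "riesz_kernel \<alpha>" by fact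
  let ?\<kappa> = "riesz_kernel \<alpha> :: 'a \<Rightarrow> ennreal"
  obtain P where P: "energy ?\<kappa> (indicat_real E) = ennreal P" "P \<ge> 0"
    using E(2) by (cases "energy ?\<kappa> (indicat_real E)") auto
  \<comment> \<open>levels are chosen in \<open>(\<theta>, 1 - \<theta>)\<close>, at the cost of a factor \<open>1 / (1 - 2 * \<theta>)\<close> in the energy\<close>
  define \<theta> where "\<theta> = e / (8 * (P + e))"
  have \<theta>: "\<theta> > 0" "\<theta> \<le> 1 / 2" using e P by (auto simp: \<theta>_def field_simps)
  have budget: "P + e / 4 + e / 4 < (P + e) * (1 - 2 * \<theta>)"
  proof -
    have "(P + e) * (1 - 2 * \<theta>) = P + e - e / 4"
      using e P by (simp add: \<theta>_def field_simps)
    then show ?thesis using e by simp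
  qed
  \<comment> \<open>the factor \<open>\<theta>\<close> is lost again in Chebyshev's inequality for the measure of \<open>A \<Delta> E\<close>\<close>
  define e' where "e' = min (e / 4) (\<theta> * e)"
  have e': "e' > 0" "e' \<le> e / 4" "e' \<le> \<theta> * e" using e \<theta> by (auto simp: e'_def)
  have int: "(\<integral>\<^sup>+ z. ?\<kappa> z * ennreal (min 1 (norm z)) \<partial>lborel) < \<infinity>"
    using limit_integrable by (simp add: mult.commute)
  obtain v R C where v: "v \<in> borel_measurable borel" "\<And>x. 0 \<le> v x" "\<And>x. v x \<le> 1"
    "\<And>x. norm x \<ge> R \<Longrightarrow> v x = 0" "C \<ge> 0"
    "\<And>z. increment v z \<le> ennreal (C * min 1 (norm z))"
    "(\<integral>\<^sup>+ x. ennreal \<bar>v x - indicat_real E x\<bar> \<partial>lborel) \<le> ennreal e'"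
    "energy ?\<kappa> v \<le> energy ?\<kappa> (indicat_real E) + ennreal e'"
    using approximate_by_bounded_lipschitz[OF \<alpha> \<open>E \<in> sets borel\<close> E int e'(1)] by blast
  note [measurable] = v(1)
  have "(\<lambda>n. ennreal C * excess n) \<longlonglongrightarrow> ennreal C * 0"
    by (intro ennreal_tendsto_cmult excess_tendsto) simp
  then have small: "\<forall>\<^sub>F n in sequentially. ennreal C * excess n < ennreal (e / 4)"
    by (rule order_tendstoD(2)) (use e in simp)
  show thesis
  proof (rule that[of R])
    show "\<forall>\<^sub>F n in sequentially. \<exists>A \<in> sets borel. A \<subseteq> ball 0 R \<and>
      (\<integral>\<^sup>+ x. ennreal \<bar>indicat_real A x - indicat_real E x\<bar> \<partial>lborel) \<le> ennreal e \<and>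
      energy (k n) (indicat_real A) \<le> energy ?\<kappa> (indicat_real E) + ennreal e"
      using small
    proof eventually_elim
      case (elim n)
      have "energy (k n) v \<le> energy ?\<kappa> v + ennreal C * excess n"
        using v by (intro energy_le_excess) auto
      also have "\<dots> \<le> (ennreal P + ennreal (e / 4)) + ennreal (e / 4)"
      proof (rule add_mono)
        have "ennreal P + ennreal e' \<le> ennreal P + ennreal (e / 4)"
          using e'(2) by (intro add_left_mono ennreal_leI)
        then show "energy ?\<kappa> v \<le> ennreal P + ennreal (e / 4)"
          using v(8) unfolding P(1) by (rule order_trans[rotated])
      qed (use elim in simp)
      also have "\<dots> = ennreal (P + e / 4 + e / 4)"
        using P e by (simp flip: ennreal_plus)
      also have "\<dots> < ennreal ((P + e) * (1 - 2 * \<theta>))"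
        using budget P e by (intro ennreal_lessI) (auto intro: le_less_trans[rotated])
      also have "\<dots> = ennreal (P + e) * ennreal (1 - 2 * \<theta>)"
        using P e \<theta> by (intro ennreal_mult) auto
      finally obtain t where t: "\<theta> < t" "t < 1 - \<theta>" "energy (k n) (indicat_real {x. t < v x}) < ennreal (P + e)"
        using v \<theta> by (auto elim!: coarea_level[of v "k n" \<theta> "ennreal (P + e)", rotated 6])
      let ?A = "{x. t < v x}"
      have [measurable]: "?A \<in> sets borel" by measurable
      have "?A \<subseteq> ball 0 R"
      proof
        fix x assume "x \<in> ?A"
        then have "v x \<noteq> 0" using t \<theta> by auto
        then show "x \<in> ball 0 R" using v(4)[of x] by (auto simp: not_le[symmetric])
      qed
      moreover have "(\<integral>\<^sup>+ x. ennreal \<bar>indicat_real ?A x - indicat_real E x\<bar> \<partial>lborel) \<le> ennreal e"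
      proof -
        have "ennreal \<bar>indicat_real ?A x - indicat_real E x\<bar> \<le> ennreal (1 / \<theta>) * ennreal \<bar>v x - indicat_real E x\<bar>" for x
        proof -
          have "\<theta> * \<bar>indicat_real ?A x - indicat_real E x\<bar> \<le> \<bar>v x - indicat_real E x\<bar>"
            using t \<theta> v(2,3)[of x] by (auto simp: indicator_def)
          then have "\<bar>indicat_real ?A x - indicat_real E x\<bar> \<le> 1 / \<theta> * \<bar>v x - indicat_real E x\<bar>"
            using \<theta> by (simp add: field_simps)
          then show ?thesis using \<theta> by (subst ennreal_mult[symmetric]) (auto intro: ennreal_leI)
        qed
        then have "(\<integral>\<^sup>+ x. ennreal \<bar>indicat_real ?A x - indicat_real E x\<bar> \<partial>lborel)
            \<le> (\<integral>\<^sup>+ x. ennreal (1 / \<theta>) * ennreal \<bar>v x - indicat_real E x\<bar> \<partial>lborel)"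
          by (intro nn_integral_mono)
        also have "\<dots> = ennreal (1 / \<theta>) * (\<integral>\<^sup>+ x. ennreal \<bar>v x - indicat_real E x\<bar> \<partial>lborel)"
          by (intro nn_integral_cmult) measurable
        also have "\<dots> \<le> ennreal (1 / \<theta>) * ennreal (\<theta> * e)"
          using v(7) e'(3) by (intro mult_left_mono) (auto intro: order_trans ennreal_leI)
        also have "\<dots> = ennreal e"
          using \<theta> e by (subst ennreal_mult[symmetric]) auto
        finally show ?thesis .
      qed
      moreover have "energy (k n) (indicat_real ?A) \<le> energy ?\<kappa> (indicat_real E) + ennreal e"
        using t(3) P e by simp
      ultimately show ?case using \<open>?A \<in> sets borel\<close> by blast
    qed
  qed
qed

text \<open>
  If \<open>E\<close> has infinite measure, the complements of the approximations of \<open>- E\<close> are used. Such a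
  complement meets each ball of radius \<open>\<epsilon> n / 2\<close> in positive measure, because what it omits lies in the
  smaller \<open>ball 0 R\<close>.
\<close>

lemma recovery_indecomposable:
  fixes k :: "nat \<Rightarrow> 'a::euclidean_space \<Rightarrow> ennreal"
  assumes conv: "kernel_convergence k (riesz_kernel \<alpha>)" and \<alpha>: "0 < \<alpha>" "\<alpha> < 1"
    and k: "\<And>n. AE z in lborel. k n z = ennreal (1 / norm z) * \<rho> n z"
    and supp: "\<And>n. essential_support (\<rho> n) = cball 0 (\<epsilon> n)" "\<And>n. \<epsilon> n > 0"
      "filterlim \<epsilon> at_top sequentially"
    and E_meas [measurable]: "E \<in> sets borel"
    and E: "energy (riesz_kernel \<alpha>) (indicat_real E) < \<infinity>"
    and e: "e > 0"
  shows "\<forall>\<^sub>F n in sequentially. \<exists>A. A \<in> sets borel \<and>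
    (\<integral>\<^sup>+ x. ennreal \<bar>indicat_real A x - indicat_real E x\<bar> \<partial>lborel) \<le> ennreal e \<and>
    connected_perimeter (\<rho> n) A \<le> energy (riesz_kernel \<alpha>) (indicat_real E) + ennreal e"
proof -
  interpret kernel_convergence k "riesz_kernel \<alpha>" by fact
  let ?\<kappa> = "riesz_kernel \<alpha> :: 'a \<Rightarrow> ennreal"
  have connected: "connected_perimeter (\<rho> n) A \<le> energy ?\<kappa> (indicat_real E) + ennreal e"
    if [measurable]: "A \<in> sets borel"
      and le: "energy (k n) (indicat_real A) \<le> energy ?\<kappa> (indicat_real E) + ennreal e"
      and A: "A \<subseteq> ball 0 (\<epsilon> n / 2) \<or> (\<forall>x. 0 < emeasure lborel (A \<inter> ball x (\<epsilon> n / 2)))" for A n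
  proof -
    have "energy (k n) (indicat_real A) < \<infinity>"
      using le E by (simp add: le_less_trans)
    then have "indecomposable (\<rho> n) A"
      by (intro indecomposableI[OF _ _ k supp(1,2) _ A]) measurable
    moreover have "nonlocal_perimeter (\<rho> n) A = energy (k n) (indicat_real A)"
      by (intro nonlocal_perimeter_eq_energy k) auto
    ultimately show ?thesis using le by (simp add: connected_perimeter_def)
  qed
  have large: "\<forall>\<^sub>F n in sequentially. \<bar>R\<bar> < \<epsilon> n / 2" for R
    using supp(3) unfolding filterlim_at_top_dense
    by (auto elim!: allE[of _ "2 * \<bar>R\<bar>"] eventually_mono)
  from finite_or_cofinite_measure[OF \<alpha> E_meas E] show ?thesis
  proof
    assume "emeasure lborel E < \<infinity>"
    from recovery_finite_measure[OF conv \<alpha>(1) E_meas this E e] obtain R where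
      "\<forall>\<^sub>F n in sequentially. \<exists>A \<in> sets borel. A \<subseteq> ball 0 R \<and>
      (\<integral>\<^sup>+ x. ennreal \<bar>indicat_real A x - indicat_real E x\<bar> \<partial>lborel) \<le> ennreal e \<and>
      energy (k n) (indicat_real A) \<le> energy ?\<kappa> (indicat_real E) + ennreal e" .
    then show ?thesis using large[of R]
    proof eventually_elim
      case (elim n)
      then obtain A where A: "A \<in> sets borel" "A \<subseteq> ball 0 R"
        "(\<integral>\<^sup>+ x. ennreal \<bar>indicat_real A x - indicat_real E x\<bar> \<partial>lborel) \<le> ennreal e"
        "energy (k n) (indicat_real A) \<le> energy ?\<kappa> (indicat_real E) + ennreal e" by blast
      have "ball (0 :: 'a) R \<subseteq> ball 0 (\<epsilon> n / 2)" using elim(2) by (intro subset_ball) simp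
      then show ?case using A connected[of A n] by blast
    qed
  next
    assume fin: "emeasure lborel (- E) < \<infinity>"
    have "energy ?\<kappa> (indicat_real (- E)) < \<infinity>" using E by (simp add: energy_Compl)
    from recovery_finite_measure[OF conv \<alpha>(1) _ fin this e] obtain R where
      "\<forall>\<^sub>F n in sequentially. \<exists>A \<in> sets borel. A \<subseteq> ball 0 R \<and>
      (\<integral>\<^sup>+ x. ennreal \<bar>indicat_real A x - indicat_real (- E) x\<bar> \<partial>lborel) \<le> ennreal e \<and>
      energy (k n) (indicat_real A) \<le> energy ?\<kappa> (indicat_real (- E)) + ennreal e" by auto
    then show ?thesis using large[of R]
    proof eventually_elim
      case (elim n)
      then obtain A where A: "A \<in> sets borel" "A \<subseteq> ball 0 R"
        "(\<integral>\<^sup>+ x. ennreal \<bar>indicat_real A x - indicat_real (- E) x\<bar> \<partial>lborel) \<le> ennreal e"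
        "energy (k n) (indicat_real A) \<le> energy ?\<kappa> (indicat_real (- E)) + ennreal e" by blast
      note A(1) [measurable]
      have "0 < emeasure lborel (- A \<inter> ball x (\<epsilon> n / 2))" for x
      proof (rule ccontr)
        assume "\<not> ?thesis"
        then have zero: "emeasure lborel (- A \<inter> ball x (\<epsilon> n / 2)) = 0" by simp
        have "emeasure lborel (ball x (\<epsilon> n / 2))
            \<le> emeasure lborel (- A \<inter> ball x (\<epsilon> n / 2) \<union> ball 0 \<bar>R\<bar>)"
          using A(2) by (intro emeasure_mono) (auto simp: subset_iff)
        also have "\<dots> \<le> emeasure lborel (- A \<inter> ball x (\<epsilon> n / 2)) + emeasure lborel (ball (0 :: 'a) \<bar>R\<bar>)"
          by (intro emeasure_subadditive) auto
        finally have "unit_ball_vol DIM('a) * (\<epsilon> n / 2) ^ DIM('a) \<le> unit_ball_vol DIM('a) * \<bar>R\<bar> ^ DIM('a)"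
          using zero supp(2)[of n] by (simp add: emeasure_ball)
        then have "(\<epsilon> n / 2) ^ DIM('a) \<le> \<bar>R\<bar> ^ DIM('a)"
          by (simp add: mult_le_cancel_left_pos)
        moreover have "\<bar>R\<bar> ^ DIM('a) < (\<epsilon> n / 2) ^ DIM('a)"
          using elim(2) by (intro power_strict_mono) auto
        ultimately show False by simp
      qed
      moreover have "\<bar>indicat_real (- A) x - indicat_real E x\<bar> = \<bar>indicat_real A x - indicat_real (- E) x\<bar>" for x
        by (auto simp: indicator_def)
      ultimately show ?case
        using A connected[of "- A" n] by (intro exI[of _ "- A"]) (auto simp: energy_Compl)
    qed
  qed
qed

section \<open>Gamma-convergence\<close>

text \<open>
  The lower bound is \<open>energy_le_liminf\<close> for Borel representatives; the recovery sequence is a diagonal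
  choice from \<open>recovery_indecomposable\<close>, needed only when the fractional perimeter is finite.
\<close>

lemma Gamma_converges_connected_perimeter:
  fixes k :: "nat \<Rightarrow> 'a::euclidean_space \<Rightarrow> ennreal"
  assumes conv: "kernel_convergence k (riesz_kernel \<alpha>)" and \<alpha>: "0 < \<alpha>" "\<alpha> < 1"
    and k: "\<And>n. AE z in lborel. k n z = ennreal (1 / norm z) * \<rho> n z"
    and supp: "\<And>n. essential_support (\<rho> n) = cball 0 (\<epsilon> n)" "\<And>n. \<epsilon> n > 0"
      "filterlim \<epsilon> at_top sequentially"
  shows "Gamma_converges (\<lambda>n. connected_perimeter (\<rho> n)) (fractional_perimeter \<alpha>)"
  unfolding Gamma_converges_def
proof (intro ballI conjI allI impI)
  interpret kernel_convergence k "riesz_kernel \<alpha>" by fact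
  fix E :: "'a set" assume E: "E \<in> sets lebesgue"
  obtain F where F: "F \<in> sets borel" "AE x in lborel. x \<in> E \<longleftrightarrow> x \<in> F"
    using E by (rule lebesgue_set_borel_version)
  have PE: "fractional_perimeter \<alpha> E = energy (riesz_kernel \<alpha>) (indicat_real F)"
    using F by (rule fractional_perimeter_eq_energy)
  {
    fix En assume En: "(\<forall>n. En n \<in> sets lebesgue) \<and> converges_in_measure En E"
    have "\<exists>Fn. \<forall>n. Fn n \<in> sets borel \<and> (AE x in lborel. x \<in> En n \<longleftrightarrow> x \<in> Fn n)"
      by (intro choice allI) (metis En lebesgue_set_borel_version)
    then obtain Fn where Fn: "\<And>n. Fn n \<in> sets borel" "\<And>n. AE x in lborel. x \<in> En n \<longleftrightarrow> x \<in> Fn n" by auto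
    have "(\<lambda>n. \<integral>\<^sup>+ x. ennreal \<bar>indicat_real (Fn n) x - indicat_real F x\<bar> \<partial>lborel) \<longlonglongrightarrow> 0"
      using En unfolding converges_in_measure_def
      by (subst emeasure_symmetric_difference[OF _ E Fn(1) F(1) Fn(2) F(2), symmetric]) auto
    then have "fractional_perimeter \<alpha> E \<le> liminf (\<lambda>n. energy (k n) (indicat_real (Fn n)))"
      unfolding PE using F(1) Fn(1) by (intro energy_le_liminf) auto
    also have "\<dots> \<le> liminf (\<lambda>n. connected_perimeter (\<rho> n) (En n))"
      by (intro Liminf_mono always_eventually allI)
        (simp add: connected_perimeter_def nonlocal_perimeter_eq_energy[OF meas_k Fn(1) k Fn(2)])
    finally show "fractional_perimeter \<alpha> E \<le> liminf (\<lambda>n. connected_perimeter (\<rho> n) (En n))" .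
  }
  show "\<exists>En. (\<forall>n. En n \<in> sets lebesgue) \<and> converges_in_measure En E
      \<and> limsup (\<lambda>n. connected_perimeter (\<rho> n) (En n)) \<le> fractional_perimeter \<alpha> E"
  proof (cases "fractional_perimeter \<alpha> E = \<infinity>")
    case True
    then show ?thesis
      using E by (intro exI[of _ "\<lambda>_. E"]) (simp add: converges_in_measure_def)
  next
    case False
    define Q where "Q j n A \<longleftrightarrow> A \<in> sets borel \<and>
        (\<integral>\<^sup>+ x. ennreal \<bar>indicat_real A x - indicat_real F x\<bar> \<partial>lborel) \<le> ennreal (1 / real (Suc j)) \<and>
        connected_perimeter (\<rho> n) A \<le> energy (riesz_kernel \<alpha>) (indicat_real F) + ennreal (1 / real (Suc j))"
      for j n A
    have fin: "energy (riesz_kernel \<alpha>) (indicat_real F) < \<infinity>"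
      using False PE by (simp add: less_top)
    have ev: "\<forall>\<^sub>F n in sequentially. \<exists>A. Q j n A" for j
      unfolding Q_def by (rule recovery_indecomposable[OF conv \<alpha> k supp F(1) fin]) simp
    have anti: "Q i n A" if "i \<le> j" "Q j n A" for i j n A
    proof -
      have "ennreal (1 / real (Suc j)) \<le> ennreal (1 / real (Suc i))"
        using \<open>i \<le> j\<close> by (intro ennreal_leI) (simp add: frac_le)
      then show ?thesis
        using \<open>Q j n A\<close> unfolding Q_def by (meson add_left_mono order_trans)
    qed
    obtain A where A: "\<And>j. \<forall>\<^sub>F n in sequentially. Q j n (A n)" "\<And>n. A n = {} \<or> (\<exists>j. Q j n (A n))"
      using diagonal_selection[of Q "{}"] ev anti by blast
    have A_meas: "A n \<in> sets borel" for n
      using A(2)[of n] by (auto simp: Q_def)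
    have "limsup (\<lambda>n. \<integral>\<^sup>+ x. ennreal \<bar>indicat_real (A n) x - indicat_real F x\<bar> \<partial>lborel) \<le> 0"
    proof (rule limsup_le_if_eventually_close)
      show "\<forall>\<^sub>F n in sequentially. (\<integral>\<^sup>+ x. ennreal \<bar>indicat_real (A n) x - indicat_real F x\<bar> \<partial>lborel)
          \<le> 0 + ennreal (1 / real (Suc j))" for j
        using A(1)[of j] by eventually_elim (simp add: Q_def)
    qed
    then have "(\<lambda>n. \<integral>\<^sup>+ x. ennreal \<bar>indicat_real (A n) x - indicat_real F x\<bar> \<partial>lborel) \<longlonglongrightarrow> 0"
      by (intro tendsto_0_if_Limsup_eq_0_ennreal) simp
    moreover have "emeasure lebesgue ((A n - E) \<union> (E - A n))
        = (\<integral>\<^sup>+ x. ennreal \<bar>indicat_real (A n) x - indicat_real F x\<bar> \<partial>lborel)" for n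
      using A_meas[of n] by (intro emeasure_symmetric_difference E F) auto
    ultimately have "converges_in_measure A E"
      unfolding converges_in_measure_def by simp
    moreover have "limsup (\<lambda>n. connected_perimeter (\<rho> n) (A n)) \<le> fractional_perimeter \<alpha> E"
      unfolding PE
    proof (rule limsup_le_if_eventually_close)
      show "\<forall>\<^sub>F n in sequentially. connected_perimeter (\<rho> n) (A n)
          \<le> energy (riesz_kernel \<alpha>) (indicat_real F) + ennreal (1 / real (Suc j))" for j
        using A(1)[of j] by eventually_elim (simp add: Q_def)
    qed
    ultimately show ?thesis using A_meas by (intro exI[of _ A]) auto
  qed
qed

theorem theorem3p7:
  fixes \<alpha> :: real and \<rho> :: "real \<Rightarrow> 'a::euclidean_space \<Rightarrow> ennreal"
  assumes "0 < \<alpha>" and "\<alpha> < 1"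
    and "\<And>\<epsilon>. \<epsilon> > 0 \<Longrightarrow> \<rho> \<epsilon> \<in> borel_measurable lebesgue"
    and "\<And>\<epsilon>. \<epsilon> > 0 \<Longrightarrow> radial (\<rho> \<epsilon>)"
    and "\<And>\<epsilon>. \<epsilon> > 0 \<Longrightarrow> essential_support (\<rho> \<epsilon>) = cball 0 \<epsilon>"
    and "AE x in lebesgue.
           ((\<lambda>\<epsilon>. ennreal (cutoff_weight x) * \<rho> \<epsilon> x)
              \<longlongrightarrow> ennreal (cutoff_weight x * fractional_kernel \<alpha> x)) at_top"
    and "tendsto_L1 (\<lambda>\<epsilon> x. ennreal (cutoff_weight x) * \<rho> \<epsilon> x)
           (\<lambda>x. ennreal (cutoff_weight x * fractional_kernel \<alpha> x)) at_top"
  shows "\<forall>\<epsilon> :: nat \<Rightarrow> real. (\<forall>n. \<epsilon> n > 0) \<and> filterlim \<epsilon> at_top sequentially \<longrightarrow>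
           Gamma_converges (\<lambda>n. connected_perimeter (\<rho> (\<epsilon> n))) (fractional_perimeter \<alpha>)"
proof (intro allI impI)
  fix \<epsilon> :: "nat \<Rightarrow> real" assume \<epsilon>: "(\<forall>n. \<epsilon> n > 0) \<and> filterlim \<epsilon> at_top sequentially"
  have "\<exists>k. \<forall>n. k n \<in> borel_measurable borel \<and> (AE z in lborel. k n z = ennreal (1 / norm z) * \<rho> (\<epsilon> n) z)"
    by (intro choice allI) (metis \<epsilon> assms(3) nonlocal_kernel_borel_version)
  then obtain k where k_meas: "\<And>n. k n \<in> borel_measurable borel"
    and k: "\<And>n. AE z in lborel. k n z = ennreal (1 / norm z) * \<rho> (\<epsilon> n) z" by auto
  let ?w = "\<lambda>z :: 'a. ennreal (min 1 (norm z))"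
  have nz: "AE z in lborel. z \<noteq> (0 :: 'a)" by (rule AE_lborel_singleton)
  have weight: "cutoff_weight z = min 1 (norm z) * (1 / norm z)" if "z \<noteq> 0" for z :: 'a
    using that by (simp add: cutoff_weight_def min_def field_simps)
  \<comment> \<open>the weight of the hypotheses turns \<open>\<rho>\<close> into \<open>min 1 |z|\<close> times the perimeter kernel \<open>\<rho> z / |z|\<close>\<close>
  have weight_k: "AE z in lborel. ?w z * k n z = ennreal (cutoff_weight z) * \<rho> (\<epsilon> n) z" for n
    using k[of n] nz
  proof eventually_elim
    case (elim z)
    have "ennreal (cutoff_weight z) = ?w z * ennreal (1 / norm z)"
      unfolding weight[OF elim(2)] by (rule ennreal_mult) auto
    then show ?case by (simp add: elim(1) mult.assoc)
  qed
  have weight_riesz: "?w z * riesz_kernel \<alpha> z = ennreal (cutoff_weight z * fractional_kernel \<alpha> z)"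
    if "z \<noteq> 0" for z :: 'a
  proof -
    have "norm z powr (real DIM('a) + \<alpha>) = norm z powr (real DIM('a) + \<alpha> - 1) * norm z"
      using that powr_add[of "norm z" "real DIM('a) + \<alpha> - 1" 1] by simp
    then show ?thesis
      using that unfolding riesz_kernel_def fractional_kernel_def weight[OF that]
      by (subst ennreal_mult[symmetric]) (auto simp: field_simps)
  qed
  have "kernel_convergence k (riesz_kernel \<alpha>)"
  proof
    have "AE z in lborel. (\<lambda>n. ennreal (cutoff_weight z) * \<rho> (\<epsilon> n) z)
        \<longlonglongrightarrow> ennreal (cutoff_weight z * fractional_kernel \<alpha> z)"
      using assms(6) unfolding AE_completion_iff
      by eventually_elim (use \<epsilon> in \<open>auto intro: filterlim_compose\<close>)
    moreover have "AE z in lborel. \<forall>n. ?w z * k n z = ennreal (cutoff_weight z) * \<rho> (\<epsilon> n) z"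
      using weight_k by (simp add: AE_all_countable)
    ultimately show "AE z in lborel. (\<lambda>n. k n z) \<longlonglongrightarrow> riesz_kernel \<alpha> z"
      using nz
    proof eventually_elim
      case (elim z)
      have inv: "ennreal (1 / min 1 (norm z)) * (?w z * a) = a" for a
      proof -
        have "min 1 (norm z) > 0" using elim(3) by simp
        then have "ennreal (1 / min 1 (norm z)) * ?w z = 1"
          by (subst ennreal_mult[symmetric]) (auto simp del: min_less_iff_conj)
        then show ?thesis by (simp flip: mult.assoc)
      qed
      have "(\<lambda>n. ?w z * k n z) \<longlonglongrightarrow> ?w z * riesz_kernel \<alpha> z"
        using elim weight_riesz by simp
      then have "(\<lambda>n. ennreal (1 / min 1 (norm z)) * (?w z * k n z))
          \<longlonglongrightarrow> ennreal (1 / min 1 (norm z)) * (?w z * riesz_kernel \<alpha> z)"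
        by (rule ennreal_tendsto_cmult[rotated]) simp
      then show ?case unfolding inv .
    qed
    have "(\<integral>\<^sup>+ z. ?w z * riesz_kernel \<alpha> z \<partial>lborel)
        = (\<integral>\<^sup>+ z. ennreal (cutoff_weight z * fractional_kernel \<alpha> z) \<partial>(lborel :: 'a measure))"
      using nz by (intro nn_integral_cong_AE) (auto simp: weight_riesz elim: eventually_mono)
    then show "(\<integral>\<^sup>+ z. ?w z * riesz_kernel \<alpha> z \<partial>lborel) < \<infinity>"
      using assms(7) by (simp add: tendsto_L1_def nn_integral_completion)
    have "(\<lambda>n. \<integral>\<^sup>+ x. (ennreal (cutoff_weight x) * \<rho> (\<epsilon> n) x - ennreal (cutoff_weight x * fractional_kernel \<alpha> x))
        + (ennreal (cutoff_weight x * fractional_kernel \<alpha> x) - ennreal (cutoff_weight x) * \<rho> (\<epsilon> n) x) \<partial>lebesgue) \<longlonglongrightarrow> 0"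
      using assms(7) \<epsilon> unfolding tendsto_L1_def by (auto intro: filterlim_compose)
    moreover have "(\<integral>\<^sup>+ x. (ennreal (cutoff_weight x) * \<rho> (\<epsilon> n) x - ennreal (cutoff_weight x * fractional_kernel \<alpha> x))
        + (ennreal (cutoff_weight x * fractional_kernel \<alpha> x) - ennreal (cutoff_weight x) * \<rho> (\<epsilon> n) x) \<partial>lebesgue)
      = (\<integral>\<^sup>+ z. (?w z * k n z - ?w z * riesz_kernel \<alpha> z) + (?w z * riesz_kernel \<alpha> z - ?w z * k n z) \<partial>lborel)" for n
      unfolding nn_integral_completion
    proof (rule nn_integral_cong_AE)
      show "AE x in lborel. (ennreal (cutoff_weight x) * \<rho> (\<epsilon> n) x - ennreal (cutoff_weight x * fractional_kernel \<alpha> x))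
        + (ennreal (cutoff_weight x * fractional_kernel \<alpha> x) - ennreal (cutoff_weight x) * \<rho> (\<epsilon> n) x)
        = (?w x * k n x - ?w x * riesz_kernel \<alpha> x) + (?w x * riesz_kernel \<alpha> x - ?w x * k n x)"
        using weight_k[of n] nz by eventually_elim (simp add: weight_riesz)
    qed
    ultimately show "(\<lambda>n. \<integral>\<^sup>+ z. (?w z * k n z - ?w z * riesz_kernel \<alpha> z)
        + (?w z * riesz_kernel \<alpha> z - ?w z * k n z) \<partial>lborel) \<longlonglongrightarrow> 0"
      by simp
  qed (use k_meas in auto)
  then show "Gamma_converges (\<lambda>n. connected_perimeter (\<rho> (\<epsilon> n))) (fractional_perimeter \<alpha>)"
    using assms(1,2,5) \<epsilon> k by (intro Gamma_converges_connected_perimeter[where \<epsilon> = \<epsilon>]) auto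
qed

end
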